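(* Let $\bar\rho>0$, $\gamma\in\mathbb{R}$, $\mu>0$, $2\mu+\mu'>0$, $P$ smooth, and assume $P'(\bar\rho)+\gamma\bar\rho<0$. Consider the linear system on $\mathbb{R}^3\times\mathbb{R}_+$ $$\partial_t\varrho+\bar\rho\,\mathrm{div}\,\mathbf{u}=0,\qquad \partial_t\mathbf{u}-\frac{\mu}{\bar\rho}\Delta\mathbf{u}-\frac{\mu+\mu'}{\bar\rho}\nabla\mathrm{div}\,\mathbf{u}+\frac{P'(\bar\rho)}{\bar\rho}\nabla\varrho+\gamma\nabla(1-\Delta)^{-1}\varrho=0.$$ Then there exists a constant $\Theta>0$ such that for any $\bar\Theta\in(0,\Theta/2]$ this linear system admits a solution $(\varrho_{\bar\Theta},\mathbf{u}_{\bar\Theta})\in C^0([0,\infty);H^3(\mathbb{R}^3))$ whose initial data $(\varrho_{0,\bar\Theta},\mathbf{u}_{0,\bar\Theta})$ (depending on $\bar\Theta$) satisfy $\|\varrho_{0,\bar\Theta}\|_{L^2}\|\mathbf{u}_{0,\bar\Theta}\|_{L^2}>0$ and, for all $t\ge 0$, $$e^{(\Theta-\bar\Theta)t}\|\varrho_{0,\bar\Theta}\|_{L^2}\le\|\varrho_{\bar\Theta}(t)\|_{L^2}\le e^{\Theta t}\|\varrho_{0,\bar\Theta}\|_{L^2},\qquad e^{(\Theta-\bar\Theta)t}\|\mathbf{u}_{0,\bar\Theta}\|_{L^2}\le\|\mathbf{u}_{\bar\Theta}(t)\|_{L^2}\le e^{\Theta t}\|\mathbf{u}_{0,\bar\T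heta}\|_{L^2}.$$
   Context: This is the linearization around the constant state $(\bar\rho,0)$ of the compressible Navier–Stokes system with Yukawa potential $\rho_t+\mathrm{div}(\rho\mathbf{u})=0$, $(\rho\mathbf{u})_t+\mathrm{div}(\rho\mathbf{u}\otimes\mathbf{u})+\nabla P(\rho)+\gamma\rho\nabla\phi=\mu\Delta\mathbf{u}+(\mu+\mu')\nabla\mathrm{div}\,\mathbf{u}$, $-\Delta\phi+\phi=\rho-\bar\rho$, where $\varrho=\rho-\bar\rho$ is the density perturbation. *)

theory Defs
  imports "HOL-Analysis.Analysis"
begin

type_synonym R3 = "real^3"

definition pd :: "3 \<Rightarrow> (R3 \<Rightarrow> real) \<Rightarrow> R3 \<Rightarrow> real" where
  "pd i f x = deriv (\<lambda>s. f (x + s *\<^sub>R axis i 1)) 0"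

fun pdl :: "3 list \<Rightarrow> (R3 \<Rightarrow> real) \<Rightarrow> R3 \<Rightarrow> real" where
  "pdl [] f = f"
| "pdl (i # is) f = pd i (pdl is f)"

definition smooth_fn :: "(R3 \<Rightarrow> real) \<Rightarrow> bool" where
  "smooth_fn f \<longleftrightarrow> (\<forall>is x. pdl is f differentiable (at x))"

definition test_fn :: "(R3 \<Rightarrow> real) \<Rightarrow> bool" where
  "test_fn \<psi> \<longleftrightarrow> smooth_fn \<psi> \<and> compact (closure {x. \<psi> x \<noteq> 0})"

definition memL2 :: "(R3 \<Rightarrow> real) \<Rightarrow> bool" where
  "memL2 f \<longleftrightarrow> f \<in> borel_measurable lborel \<and> integrable lborel (\<lambda>x. (f x)^2)"

definition L2norm :: "(R3 \<Rightarrow> real) \<Rightarrow> real" where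
  "L2norm f = sqrt (\<integral>x. (f x)^2 \<partial>lborel)"

definition L2normv :: "(R3 \<Rightarrow> R3) \<Rightarrow> real" where
  "L2normv u = sqrt (\<integral>x. (norm (u x))^2 \<partial>lborel)"

definition weak_deriv :: "3 list \<Rightarrow> (R3 \<Rightarrow> real) \<Rightarrow> (R3 \<Rightarrow> real) \<Rightarrow> bool" where
  "weak_deriv is f g \<longleftrightarrow> (\<forall>\<psi>. test_fn \<psi> \<longrightarrow>
      (\<integral>x. f x * pdl is \<psi> x \<partial>lborel) = (-1) ^ length is * (\<integral>x. g x * \<psi> x \<partial>lborel))"

definition H3 :: "(R3 \<Rightarrow> real) \<Rightarrow> bool" where
  "H3 f \<longleftrightarrow> memL2 f \<and> (\<forall>is. length is \<le> 3 \<longrightarrow> (\<exists>g. memL2 g \<and> weak_deriv is f g))"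

definition wd :: "3 list \<Rightarrow> (R3 \<Rightarrow> real) \<Rightarrow> R3 \<Rightarrow> real" where
  "wd is f = (SOME g. memL2 g \<and> weak_deriv is f g)"

definition H3norm :: "(R3 \<Rightarrow> real) \<Rightarrow> real" where
  "H3norm f = sqrt (\<Sum>is\<in>{is::3 list. length is \<le> 3}. (L2norm (wd is f))^2)"

definition C0H3 :: "(real \<Rightarrow> R3 \<Rightarrow> real) \<Rightarrow> bool" where
  "C0H3 \<rho> \<longleftrightarrow> (\<forall>t\<ge>0. H3 (\<rho> t)) \<and>
     (\<forall>t\<ge>0. ((\<lambda>s. H3norm (\<lambda>x. \<rho> s x - \<rho> t x)) \<longlongrightarrow> 0) (at t within {0..}))"

definition C0H3v :: "(real \<Rightarrow> R3 \<Rightarrow> R3) \<Rightarrow> bool" where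
  "C0H3v u \<longleftrightarrow> (\<forall>j. C0H3 (\<lambda>t x. u t x $ j))"

definition yukawa_pot :: "(R3 \<Rightarrow> real) \<Rightarrow> (R3 \<Rightarrow> real) \<Rightarrow> bool" where
  "yukawa_pot \<rho> \<phi> \<longleftrightarrow> memL2 \<phi> \<and> (\<forall>\<psi>. test_fn \<psi> \<longrightarrow>
     (\<integral>x. \<phi> x * (\<psi> x - (\<Sum>k\<in>UNIV. pdl [k,k] \<psi> x)) \<partial>lborel) = (\<integral>x. \<rho> x * \<psi> x \<partial>lborel))"

text \<open>Solution of the linearized system in C^0([0,\<infinity>);H^3), the equations holding
  in the sense of distributions in space (time derivative of the pairing with each test function).
  dP stands for P'(rho_bar).\<close>
definition lin_solution :: "real \<Rightarrow> real \<Rightarrow> real \<Rightarrow> real \<Rightarrow> real \<Rightarrow>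
    (real \<Rightarrow> R3 \<Rightarrow> real) \<Rightarrow> (real \<Rightarrow> R3 \<Rightarrow> R3) \<Rightarrow> bool" where
  "lin_solution \<rho>b \<mu> \<mu>' dP \<gamma> \<rho> u \<longleftrightarrow> C0H3 \<rho> \<and> C0H3v u \<and>
    (\<exists>\<phi>. (\<forall>t\<ge>0. yukawa_pot (\<rho> t) (\<phi> t)) \<and>
      (\<forall>\<psi> t. test_fn \<psi> \<and> t \<ge> 0 \<longrightarrow>
        ((\<lambda>s. \<integral>x. \<rho> s x * \<psi> x \<partial>lborel) has_real_derivative
            \<rho>b * (\<Sum>k\<in>UNIV. \<integral>x. u t x $ k * pdl [k] \<psi> x \<partial>lborel)) (at t within {0..}) \<and>
        (\<forall>j. ((\<lambda>s. \<integral>x. u s x $ j * \<psi> x \<partial>lborel) has_real_derivative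
            (\<mu> / \<rho>b * (\<Sum>k\<in>UNIV. \<integral>x. u t x $ j * pdl [k,k] \<psi> x \<partial>lborel)
             + (\<mu> + \<mu>') / \<rho>b * (\<Sum>k\<in>UNIV. \<integral>x. u t x $ k * pdl [j,k] \<psi> x \<partial>lborel)
             + dP / \<rho>b * (\<integral>x. \<rho> t x * pdl [j] \<psi> x \<partial>lborel)
             + \<gamma> * (\<integral>x. \<phi> t x * pdl [j] \<psi> x \<partial>lborel))) (at t within {0..}))))"

end

theory Submission
  imports Defs "HOL-Probability.Characteristic_Functions"
begin

text \<open>
  On the Fourier side a mode of wave number \<open>k\<close> with \<open>s = k\<^sup>2\<close> and \<open>u\<close> parallel to \<open>k\<close> evolves
  by \<open>exp (X t)\<close>, where \<open>X\<^sup>2 + \<nu> s X + s (P'(\<rho>b) + \<gamma> \<rho>b / (1 + s)) = 0\<close> and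
  \<open>\<nu> = (2 \<mu> + \<mu>') / \<rho>b\<close>.  The hypothesis says that the last bracket is negative for small \<open>s\<close>,
  and then the larger root \<open>r(s)\<close> is positive and bounded.  Let \<open>\<Theta>\<close> be the supremum of \<open>r\<close> over all
  unstable \<open>s\<close>.  Data whose spectrum is a thin shell where \<open>\<Theta> - \<Theta>b < r \<le> \<Theta>\<close> grow at a rate between
  these two bounds, by Plancherel's theorem.

  All functions being real, the Fourier transform is replaced by the Hartley transform, with kernel
  \<open>cos + sin\<close>; it is only applied to continuous compactly supported profiles and to test functions.
  Plancherel's identity follows by Gaussian regularisation.
\<close>

section \<open>The Hartley transform and Plancherel's identity\<close>

text \<open>Two obstacles shape the proof. \<open>H3norm\<close> selects weak derivatives with
  \<open>SOME\<close>, so it cannot be computed before weak derivatives are known to be unique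
  almost everywhere; this is what the bump functions are for. And \<Theta> need not be attained: for
  \<gamma> = 0 the root stays below |P'(\<rho>b)| / \<nu> and only tends to it as s grows. A nonzero
  L2 solution moreover occupies a set of wave numbers of positive measure, so it cannot sit on one
  sphere |k| = const. The loss \<Theta>b pays for both. The exponent is a radial, hence even,
  function of the wave vector, so it commutes with the reflection that each derivative causes on the
  Hartley side. It is the root truncated to [\<Theta> - \<Theta>b, \<Theta>]; on the spectrum of the
  data the truncation changes nothing, and elsewhere it makes the bounds hold without case
  distinction. Density and velocity carry the same time factor, hence obey the same two
  rates.\<close>

lemma integral_lborel_affine:
  fixes f :: "'a::euclidean_space \<Rightarrow> real"
  assumes [measurable]: "f \<in> borel_measurable borel" and c: "c \<noteq> 0"
  shows "(\<integral>x. f x \<partial>lborel) = \<bar>c\<bar> ^ DIM('a) * (\<integral>x. f (t + c *\<^sub>R x) \<partial>lborel)"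
proof -
  have "(\<integral>x. f x \<partial>lborel) =
      (\<integral>x. f x \<partial>density (distr lborel borel (\<lambda>x. t + c *\<^sub>R x)) (\<lambda>_. ennreal (\<bar>c\<bar> ^ DIM('a))))"
    using lborel_affine[OF c, of t] by simp
  also have "\<dots> = \<bar>c\<bar> ^ DIM('a) * (\<integral>x. f (t + c *\<^sub>R x) \<partial>lborel)"
    by (subst integral_density) (auto simp: integral_distr)
  finally show ?thesis .
qed

lemma integrable_lborel_affine:
  fixes f :: "'a::euclidean_space \<Rightarrow> real"
  assumes f: "integrable lborel f" and c: "c \<noteq> 0"
  shows "integrable lborel (\<lambda>x. f (t + c *\<^sub>R x))"
proof -
  have [measurable]: "f \<in> borel_measurable borel"
    using f by simp
  have "integrable (density (distr lborel borel (\<lambda>x. t + c *\<^sub>R x)) (\<lambda>_. ennreal (\<bar>c\<bar> ^ DIM('a)))) f"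
    using lborel_affine[OF c, of t] f by simp
  then have "integrable lborel (\<lambda>x. \<bar>c\<bar> ^ DIM('a) *\<^sub>R f (t + c *\<^sub>R x))"
    by (subst (asm) integrable_density) (auto simp: integrable_distr_eq)
  then show ?thesis using c by simp
qed

lemma integral_reflect_lborel:
  fixes f :: "'a::euclidean_space \<Rightarrow> real"
  assumes [measurable]: "f \<in> borel_measurable borel"
  shows "(\<integral>x. f (- x) \<partial>lborel) = (\<integral>x. f x \<partial>lborel)"
  using integral_lborel_affine[of f "-1" 0] assms by simp

lemma integral_translate_lborel:
  fixes f :: "'a::euclidean_space \<Rightarrow> real"
  assumes [measurable]: "f \<in> borel_measurable borel"
  shows "(\<integral>x. f (t + x) \<partial>lborel) = (\<integral>x. f x \<partial>lborel)"
  using integral_lborel_affine[of f 1 t] assms by simp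

text \<open>The integrand is dominated by \<open>C\<close> times the tensor product of
  \<open>a\<close> and \<open>b\<close>, which is integrable on the product space. Every exchange of
  integrals below has this shape, with \<open>cas\<close> as kernel.\<close>

lemma Fubini_bounded_kernel:
  fixes a :: "'a::euclidean_space \<Rightarrow> real" and b :: "'b::euclidean_space \<Rightarrow> real"
  assumes a: "integrable lborel a" and b: "integrable lborel b"
    and k[measurable]: "case_prod k \<in> borel_measurable (borel \<Otimes>\<^sub>M borel)"
    and C: "\<And>x y. \<bar>k x y\<bar> \<le> C"
  shows "(\<integral>x. a x * (\<integral>y. b y * k x y \<partial>lborel) \<partial>lborel) = (\<integral>y. b y * (\<integral>x. a x * k x y \<partial>lborel) \<partial>lborel)"
proof -
  have [measurable]: "a \<in> borel_measurable borel" "b \<in> borel_measurable borel"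
    using a b by simp_all
  have i: "integrable lborel (\<lambda>y. C * \<bar>b y\<bar>)"
    using b by simp
  have "integrable (lborel \<Otimes>\<^sub>M lborel) (\<lambda>(x, y). a x * b y)"
  proof (rule lborel_pair.Fubini_integrable)
    show "integrable lborel (\<lambda>x. \<integral>y. norm (case (x, y) of (x, y) \<Rightarrow> a x * b y) \<partial>lborel)"
      using a b by (simp add: abs_mult)
    show "AE x in lborel. integrable lborel (\<lambda>y. case (x, y) of (x, y) \<Rightarrow> a x * b y)"
      using b by simp
  qed measurable
  then have "integrable (lborel \<Otimes>\<^sub>M lborel) (\<lambda>p. C * (case p of (x, y) \<Rightarrow> a x * b y))"
    by (intro integrable_mult_right)
  then have "integrable (lborel \<Otimes>\<^sub>M lborel) (\<lambda>(x, y). a x * (b y * k x y))"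
  proof (rule Bochner_Integration.integrable_bound)
    show "AE x in lborel \<Otimes>\<^sub>M lborel.
        norm (case x of (x, y) \<Rightarrow> a x * (b y * k x y)) \<le> norm (C * (case x of (x, y) \<Rightarrow> a x * b y))"
    proof (intro AE_I2, clarsimp simp: abs_mult)
      fix x y
      have "\<bar>a x\<bar> * \<bar>b y\<bar> * \<bar>k x y\<bar> \<le> \<bar>a x\<bar> * \<bar>b y\<bar> * \<bar>C\<bar>"
        using C[of x y] by (intro mult_left_mono) auto
      then show "\<bar>a x\<bar> * (\<bar>b y\<bar> * \<bar>k x y\<bar>) \<le> \<bar>C\<bar> * (\<bar>a x\<bar> * \<bar>b y\<bar>)"
        by (simp add: mult_ac)
    qed
  qed measurable
  from lborel_pair.Fubini_integral[OF this]
  have "(\<integral>x. (\<integral>y. a x * (b y * k x y) \<partial>lborel) \<partial>lborel) = (\<integral>y. (\<integral>x. a x * (b y * k x y) \<partial>lborel) \<partial>lborel)"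
    by simp
  moreover have "(\<lambda>y. (\<integral>x. a x * (b y * k x y) \<partial>lborel)) = (\<lambda>y. b y * (\<integral>x. a x * k x y \<partial>lborel))"
    by (simp add: mult.left_commute flip: integral_mult_right_zero)
  ultimately show ?thesis by simp
qed

text \<open>The class is stable under multiplication by any continuous symbol, growing or not, so
  polynomial and exponential factors never require a decay estimate.\<close>

definition Cc :: "('a::euclidean_space \<Rightarrow> real) \<Rightarrow> bool" where
  "Cc g \<longleftrightarrow> continuous_on UNIV g \<and> (\<exists>R. \<forall>x. norm x > R \<longrightarrow> g x = 0)"

lemma Cc_continuous: "Cc g \<Longrightarrow> continuous_on UNIV g"
  by (simp add: Cc_def)

lemma Cc_measurable: "Cc g \<Longrightarrow> g \<in> borel_measurable borel"
  by (simp add: Cc_def borel_measurable_continuous_onI)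

lemma Cc_bounded:
  assumes "Cc g" obtains M where "M > 0" "\<And>x. \<bar>g x\<bar> \<le> M"
proof -
  obtain R where R: "\<And>x. norm x > R \<Longrightarrow> g x = 0" and c: "continuous_on UNIV g"
    using assms by (auto simp: Cc_def)
  have "compact (g ` cball 0 R)"
    using c by (intro compact_continuous_image) (auto intro: continuous_on_subset)
  then obtain M where M: "\<And>x. x \<in> cball 0 R \<Longrightarrow> norm (g x) \<le> M"
    using compact_imp_bounded bounded_iff by (metis imageI)
  have "\<bar>g x\<bar> \<le> max M 1" for x
    using M[of x] R[of x] by (cases "norm x > R") auto
  then show ?thesis using that[of "max M 1"] by auto
qed

lemma Cc_integrable:
  assumes "Cc g" shows "integrable lborel g"
proof -
  obtain R where R: "\<And>x. norm x > R \<Longrightarrow> g x = 0" and c: "continuous_on UNIV g"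
    using assms by (auto simp: Cc_def)
  have "integrable lborel (\<lambda>x. indicator (cball 0 R) x *\<^sub>R g x)"
    using c by (intro borel_integrable_compact) (auto intro: continuous_on_subset)
  also have "(\<lambda>x. indicator (cball 0 R) x *\<^sub>R g x) = g"
    using R by (auto simp: fun_eq_iff indicator_def not_le)
  finally show ?thesis .
qed

lemma Cc_mult: "continuous_on UNIV h \<Longrightarrow> Cc g \<Longrightarrow> Cc (\<lambda>x. h x * g x)"
  unfolding Cc_def by (auto intro!: continuous_intros)

lemma Cc_reflect:
  assumes "Cc g" shows "Cc (\<lambda>x. g (- x))"
proof -
  have "continuous_on UNIV (\<lambda>x. g (- x))"
    by (rule continuous_on_compose2[OF Cc_continuous[OF assms]]) (auto intro: continuous_intros)
  then show ?thesis
    using assms unfolding Cc_def by (metis norm_minus_cancel)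
qed

lemma Cc_diff: "Cc f \<Longrightarrow> Cc g \<Longrightarrow> Cc (\<lambda>x. f x - g x)"
  unfolding Cc_def
  by (auto intro!: continuous_intros) (metis diff_zero max_less_iff_conj)

lemma Cc_power2: "Cc g \<Longrightarrow> Cc (\<lambda>x. (g x)\<^sup>2)"
  using Cc_mult[OF Cc_continuous] by (auto simp: power2_eq_square)

section \<open>The Hartley kernel and the self-adjointness of its transform\<close>

definition cas :: "real \<Rightarrow> real" where
  "cas \<theta> = cos \<theta> + sin \<theta>"

text \<open>No normalising factor is included, so Plancherel's identity carries
  \<open>(2 * pi) ^ DIM('a)\<close>; the constant is common to all norms that are compared.\<close>

definition hartley :: "('a::euclidean_space \<Rightarrow> real) \<Rightarrow> 'a \<Rightarrow> real" where
  "hartley g x = (\<integral>\<xi>. g \<xi> * cas (x \<bullet> \<xi>) \<partial>lborel)"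

lemma abs_cas_le: "\<bar>cas \<theta>\<bar> \<le> 2"
  unfolding cas_def using abs_cos_le_one[of \<theta>] abs_sin_le_one[of \<theta>] by linarith

lemma abs_mult_cas_le: "\<bar>a * cas \<theta>\<bar> \<le> 2 * \<bar>a\<bar>"
  using mult_left_mono[OF abs_cas_le[of \<theta>] abs_ge_zero[of a]] by (simp add: abs_mult)

lemma cas_measurable[measurable]: "cas \<in> borel_measurable borel"
  unfolding cas_def[abs_def] by measurable

lemma hartley_integrand_integrable:
  fixes g :: "'a::euclidean_space \<Rightarrow> real"
  assumes g: "integrable lborel g"
  shows "integrable lborel (\<lambda>\<xi>. g \<xi> * cas (x \<bullet> \<xi>))"
proof (rule Bochner_Integration.integrable_bound)
  have [measurable]: "g \<in> borel_measurable borel" using g by simp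
  show "(\<lambda>\<xi>. g \<xi> * cas (x \<bullet> \<xi>)) \<in> borel_measurable lborel" by measurable
  show "integrable lborel (\<lambda>\<xi>. 2 * g \<xi>)" using g by simp
  show "AE \<xi> in lborel. norm (g \<xi> * cas (x \<bullet> \<xi>)) \<le> norm (2 * g \<xi>)"
    unfolding real_norm_def abs_mult[of 2] by (intro AE_I2) (simp add: abs_mult_cas_le)
qed

lemma hartley_measurable[measurable]:
  fixes g :: "'a::euclidean_space \<Rightarrow> real"
  assumes [measurable]: "g \<in> borel_measurable borel"
  shows "hartley g \<in> borel_measurable borel"
  unfolding hartley_def[abs_def] by measurable

lemma hartley_bound:
  assumes g: "integrable lborel g"
  shows "\<bar>hartley g x\<bar> \<le> 2 * (\<integral>\<xi>. \<bar>g \<xi>\<bar> \<partial>lborel)"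
proof -
  have "\<bar>hartley g x\<bar> \<le> (\<integral>\<xi>. \<bar>g \<xi> * cas (x \<bullet> \<xi>)\<bar> \<partial>lborel)"
    unfolding hartley_def by (rule integral_abs_bound)
  also have "\<dots> \<le> (\<integral>\<xi>. 2 * \<bar>g \<xi>\<bar> \<partial>lborel)"
    by (intro integral_mono integrable_abs hartley_integrand_integrable integrable_mult_right g abs_mult_cas_le)
  finally show ?thesis by simp
qed

text \<open>The kernel is symmetric in its two variables, so the transform is its own adjoint. This
  moves every pairing with a test function to the frequency side.\<close>

lemma integral_hartley_swap:
  fixes g \<psi> :: "'a::euclidean_space \<Rightarrow> real"
  assumes "integrable lborel g" "integrable lborel \<psi>"
  shows "(\<integral>x. hartley g x * \<psi> x \<partial>lborel) = (\<integral>\<xi>. g \<xi> * hartley \<psi> \<xi> \<partial>lborel)"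
  unfolding hartley_def
  using Fubini_bounded_kernel[OF assms(2,1), of "\<lambda>x \<xi>. cas (x \<bullet> \<xi>)" 2] abs_cas_le
  by (simp add: mult.commute inner_commute)

section \<open>Gaussian integrals, reduced to one dimension by coordinates\<close>

lemma integral_lborel_Basis_prod:
  fixes f :: "'a::euclidean_space \<Rightarrow> real \<Rightarrow> complex"
  assumes f: "\<And>b. b \<in> Basis \<Longrightarrow> integrable lborel (f b)"
  shows "(\<integral>x. (\<Prod>b\<in>Basis. f b (x \<bullet> b)) \<partial>lborel) = (\<Prod>b\<in>Basis. \<integral>x. f b x \<partial>lborel)"
    and "integrable lborel (\<lambda>x. \<Prod>b\<in>Basis. f b (x \<bullet> b))"
proof -
  interpret product_sigma_finite "\<lambda>_::'a. lborel :: real measure" ..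
  have [measurable]: "f b \<in> borel_measurable borel" if "b \<in> Basis" for b
    using f[OF that] by simp
  have eq: "(\<Prod>b\<in>Basis. f b ((\<Sum>b\<in>Basis. g b *\<^sub>R b) \<bullet> b)) = (\<Prod>b\<in>Basis. f b (g b))" for g
    by (intro prod.cong) auto
  have m: "(\<lambda>x. \<Prod>b\<in>Basis. f b (x \<bullet> b)) \<in> borel_measurable borel"
    by measurable
  show "(\<integral>x. (\<Prod>b\<in>Basis. f b (x \<bullet> b)) \<partial>lborel) = (\<Prod>b\<in>Basis. \<integral>x. f b x \<partial>lborel)"
    by (subst lborel_eq, subst integral_distr)
       (use f m in \<open>auto simp: eq product_integral_prod\<close>)
  show "integrable lborel (\<lambda>x. \<Prod>b\<in>Basis. f b (x \<bullet> b))"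
    by (subst lborel_eq, subst integrable_distr_eq)
       (use f m in \<open>auto simp: eq intro!: product_integrable_prod\<close>)
qed

definition gaussian :: "'a::euclidean_space \<Rightarrow> real" where
  "gaussian x = exp (- (norm x)\<^sup>2 / 2)"

lemma gaussian_measurable[measurable]: "gaussian \<in> borel_measurable borel"
  unfolding gaussian_def[abs_def] by measurable

lemma gaussian_prod: "gaussian (x::'a::euclidean_space) = sqrt (2 * pi) ^ DIM('a) * (\<Prod>b\<in>Basis. std_normal_density (x \<bullet> b))"
proof -
  have "gaussian x = exp (\<Sum>b\<in>Basis. - (x \<bullet> b)\<^sup>2 / 2)"
    unfolding gaussian_def power2_norm_eq_inner
    by (subst euclidean_inner) (simp add: sum_negf sum_divide_distrib power2_eq_square)
  also have "\<dots> = (\<Prod>b\<in>Basis. sqrt (2 * pi) * std_normal_density (x \<bullet> b))"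
    by (simp add: exp_sum std_normal_density_def)
  finally show ?thesis by (simp add: prod.distrib)
qed

text \<open>Up to a constant the Gaussian is a product of standard normal densities, and the
  characteristic function of each factor is known.\<close>

lemma gaussian_char:
  fixes \<zeta> :: "'a::euclidean_space"
  shows "integrable lborel (\<lambda>x. gaussian x *\<^sub>R iexp (x \<bullet> \<zeta>))"
    and "(\<integral>x. gaussian x *\<^sub>R iexp (x \<bullet> \<zeta>) \<partial>lborel) = complex_of_real (sqrt (2 * pi) ^ DIM('a) * gaussian \<zeta>)"
proof -
  let ?f = "\<lambda>b t. complex_of_real (std_normal_density t) * iexp (\<zeta> \<bullet> b * t)"
  have i1: "integrable lborel (?f b)" for b
  proof (rule Bochner_Integration.integrable_bound)
    show "integrable lborel std_normal_density" by simp
  qed (auto simp: norm_mult normal_density_nonneg)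
  have v1: "(\<integral>t. ?f b t \<partial>lborel) = exp (- (\<zeta> \<bullet> b)\<^sup>2 / 2)" for b
  proof -
    have "char std_normal_distribution (\<zeta> \<bullet> b) = (\<integral>t. ?f b t \<partial>lborel)"
      unfolding char_def
      by (subst integral_density) (auto simp: normal_density_nonneg scaleR_conv_of_real)
    then show ?thesis by (simp add: char_std_normal_distribution)
  qed
  have eq: "gaussian x *\<^sub>R iexp (x \<bullet> \<zeta>)
      = complex_of_real (sqrt (2 * pi) ^ DIM('a)) * (\<Prod>b\<in>Basis. ?f b (x \<bullet> b))" for x
  proof -
    have "iexp (x \<bullet> \<zeta>) = (\<Prod>b\<in>Basis. iexp (\<zeta> \<bullet> b * (x \<bullet> b)))"
      by (subst euclidean_inner) (simp add: exp_sum sum_distrib_left mult_ac)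
    then show ?thesis
      by (simp add: gaussian_prod scaleR_conv_of_real prod.distrib)
  qed
  show "integrable lborel (\<lambda>x. gaussian x *\<^sub>R iexp (x \<bullet> \<zeta>))"
    unfolding eq by (intro integrable_mult_right integral_lborel_Basis_prod i1)
  have "(\<integral>x. gaussian x *\<^sub>R iexp (x \<bullet> \<zeta>) \<partial>lborel)
      = complex_of_real (sqrt (2 * pi) ^ DIM('a)) * (\<Prod>b\<in>Basis. complex_of_real (exp (- (\<zeta> \<bullet> b)\<^sup>2 / 2)))"
    unfolding eq integral_mult_right_zero integral_lborel_Basis_prod(1)[OF i1] v1 ..
  also have "(\<Prod>b\<in>Basis. complex_of_real (exp (- (\<zeta> \<bullet> b)\<^sup>2 / 2))) = complex_of_real (gaussian \<zeta>)"
    unfolding gaussian_def power2_norm_eq_inner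
    by (subst euclidean_inner) (simp add: sum_negf sum_divide_distrib power2_eq_square flip: exp_sum of_real_prod)
  finally show "(\<integral>x. gaussian x *\<^sub>R iexp (x \<bullet> \<zeta>) \<partial>lborel) = complex_of_real (sqrt (2 * pi) ^ DIM('a) * gaussian \<zeta>)"
    by simp
qed

lemma gaussian_integrable: "integrable lborel (gaussian :: 'a::euclidean_space \<Rightarrow> real)"
  and gaussian_integral: "(\<integral>x. gaussian (x::'a) \<partial>lborel) = sqrt (2 * pi) ^ DIM('a)"
proof -
  note i = gaussian_char(1)[of "0::'a"]
  show "integrable lborel (gaussian :: 'a \<Rightarrow> real)"
    using integrable_Re[OF i] by (simp)
  have "(\<integral>x. Re (gaussian x *\<^sub>R iexp (x \<bullet> (0::'a))) \<partial>lborel) = sqrt (2 * pi) ^ DIM('a) * gaussian (0::'a)"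
    by (subst integral_Re[OF i]) (simp only: gaussian_char(2) Re_complex_of_real)
  then show "(\<integral>x. gaussian (x::'a) \<partial>lborel) = sqrt (2 * pi) ^ DIM('a)"
    by (simp add: gaussian_def)
qed

text \<open>The product of the two kernels is cos of the difference plus sin of the sum of the
  phases. The transform of the Gaussian is real, so the sine part integrates to 0.\<close>

lemma gaussian_cas:
  fixes \<xi> \<eta> :: "'a::euclidean_space"
  shows "(\<integral>x. gaussian x * cas (x \<bullet> \<xi>) * cas (x \<bullet> \<eta>) \<partial>lborel) = sqrt (2 * pi) ^ DIM('a) * gaussian (\<xi> - \<eta>)"
proof -
  note i = gaussian_char(1)[of "\<xi> - \<eta>"] and j = gaussian_char(1)[of "\<xi> + \<eta>"]
  have "gaussian x * cas (x \<bullet> \<xi>) * cas (x \<bullet> \<eta>)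
     = Re (gaussian x *\<^sub>R iexp (x \<bullet> (\<xi> - \<eta>))) + Im (gaussian x *\<^sub>R iexp (x \<bullet> (\<xi> + \<eta>)))" for x
    by (simp add: cas_def Re_exp Im_exp inner_diff_right inner_add_right cos_diff sin_add algebra_simps)
  then have "(\<integral>x. gaussian x * cas (x \<bullet> \<xi>) * cas (x \<bullet> \<eta>) \<partial>lborel)
    = (\<integral>x. Re (gaussian x *\<^sub>R iexp (x \<bullet> (\<xi> - \<eta>))) \<partial>lborel) + (\<integral>x. Im (gaussian x *\<^sub>R iexp (x \<bullet> (\<xi> + \<eta>))) \<partial>lborel)"
    using i j by (simp only: Bochner_Integration.integral_add integrable_Re integrable_Im)
  also have "\<dots> = sqrt (2 * pi) ^ DIM('a) * gaussian (\<xi> - \<eta>)"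
    by (subst integral_Re[OF i], subst integral_Im[OF j])
       (simp only: gaussian_char(2) Re_complex_of_real Im_complex_of_real add_0_right)
  finally show ?thesis .
qed

text \<open>Divided by \<open>\<sigma> ^ DIM('a)\<close>, the right-hand side is an approximate
  identity in \<xi> - \<eta> of mass \<open>(2 * pi) ^ DIM('a)\<close>: a rigorous form of the
  orthogonality of the kernels.\<close>

lemma gaussian_scale_cas:
  fixes \<xi> \<eta> :: "'a::euclidean_space"
  assumes "\<sigma> > 0"
  shows "\<sigma> ^ DIM('a) * (\<integral>x. gaussian (\<sigma> *\<^sub>R x) * cas (x \<bullet> \<xi>) * cas (x \<bullet> \<eta>) \<partial>lborel)
     = sqrt (2 * pi) ^ DIM('a) * gaussian ((\<xi> - \<eta>) /\<^sub>R \<sigma>)"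
  using integral_lborel_affine[of "\<lambda>x. gaussian x * cas (x \<bullet> (\<xi> /\<^sub>R \<sigma>)) * cas (x \<bullet> (\<eta> /\<^sub>R \<sigma>))" \<sigma> 0]
    gaussian_cas[of "\<xi> /\<^sub>R \<sigma>" "\<eta> /\<^sub>R \<sigma>"] assms
  by (simp add: scaleR_diff_right flip: mult.assoc)

lemma gaussian_shift_integrable:
  fixes g :: "'a::euclidean_space \<Rightarrow> real"
  assumes "Cc g"
  shows "integrable lborel (\<lambda>z. g (\<eta> + \<sigma> *\<^sub>R z) * gaussian z)"
proof -
  have [measurable]: "g \<in> borel_measurable borel" by (rule Cc_measurable[OF assms])
  obtain M where M: "M > 0" "\<And>x. \<bar>g x\<bar> \<le> M" using Cc_bounded[OF assms] by blast
  show ?thesis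
  proof (rule Bochner_Integration.integrable_bound)
    show "integrable lborel (\<lambda>z::'a. M * gaussian z)"
      by (intro integrable_mult_right gaussian_integrable)
    show "AE z in lborel. norm (g (\<eta> + \<sigma> *\<^sub>R z) * gaussian z) \<le> norm (M * gaussian z)"
      using M by (auto simp: abs_mult gaussian_def intro!: mult_right_mono)
  qed measurable
qed

text \<open>The weight makes all integrals absolutely convergent. Self-adjointness moves one factor
  \<open>hartley g\<close> back to \<open>g\<close>, and what remains is the smoothing of
  \<open>g\<close> by the Gaussian approximate identity.\<close>

lemma hartley_gaussian_regularised:
  fixes g :: "'a::euclidean_space \<Rightarrow> real"
  assumes g: "Cc g" and \<sigma>: "\<sigma> > 0"
  shows "integrable lborel (\<lambda>x. gaussian (\<sigma> *\<^sub>R x) * (hartley g x)\<^sup>2)"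
    and "(\<integral>x. gaussian (\<sigma> *\<^sub>R x) * (hartley g x)\<^sup>2 \<partial>lborel)
     = sqrt (2 * pi) ^ DIM('a) * (\<integral>\<eta>. g \<eta> * (\<integral>z. g (\<eta> + \<sigma> *\<^sub>R z) * gaussian z \<partial>lborel) \<partial>lborel)"
proof -
  define c where "c = sqrt (2 * pi) ^ DIM('a)"
  define G where "G = 2 * (\<integral>\<xi>. \<bar>g \<xi>\<bar> \<partial>lborel)"
  have [measurable]: "g \<in> borel_measurable borel" by (rule Cc_measurable[OF g])
  have gi: "integrable lborel g" by (rule Cc_integrable[OF g])
  have \<gamma>: "integrable lborel (\<lambda>x::'a. gaussian (\<sigma> *\<^sub>R x))"
    using integrable_lborel_affine[OF gaussian_integrable, of \<sigma> "0::'a"] \<sigma> by simp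
  have hb: "\<bar>hartley g x\<bar> \<le> G" for x unfolding G_def by (rule hartley_bound[OF gi])
  have \<gamma>h: "integrable lborel (\<lambda>x. gaussian (\<sigma> *\<^sub>R x) * hartley g x)"
  proof (rule Bochner_Integration.integrable_bound)
    show "integrable lborel (\<lambda>x::'a. G * gaussian (\<sigma> *\<^sub>R x))"
      using \<gamma> by simp
    show "AE x in lborel. norm (gaussian (\<sigma> *\<^sub>R x) * hartley g x) \<le> norm (G * gaussian (\<sigma> *\<^sub>R x))"
      unfolding real_norm_def abs_mult mult.commute[of "\<bar>G\<bar>"]
      by (intro AE_I2 mult_left_mono order_trans[OF hb]) auto
  qed measurable
  show "integrable lborel (\<lambda>x. gaussian (\<sigma> *\<^sub>R x) * (hartley g x)\<^sup>2)"
  proof (rule Bochner_Integration.integrable_bound)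
    show "integrable lborel (\<lambda>x::'a. G * (gaussian (\<sigma> *\<^sub>R x) * hartley g x))"
      using \<gamma>h by simp
    show "AE x in lborel. norm (gaussian (\<sigma> *\<^sub>R x) * (hartley g x)\<^sup>2) \<le> norm (G * (gaussian (\<sigma> *\<^sub>R x) * hartley g x))"
    proof (intro AE_I2)
      fix x
      have "\<bar>hartley g x\<bar> * \<bar>gaussian (\<sigma> *\<^sub>R x) * hartley g x\<bar> \<le> \<bar>G\<bar> * \<bar>gaussian (\<sigma> *\<^sub>R x) * hartley g x\<bar>"
        using hb[of x] by (intro mult_right_mono) auto
      then show "norm (gaussian (\<sigma> *\<^sub>R x) * (hartley g x)\<^sup>2) \<le> norm (G * (gaussian (\<sigma> *\<^sub>R x) * hartley g x))"
        by (simp add: abs_mult power2_eq_square mult_ac)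
    qed
  qed measurable
  have inner: "hartley (\<lambda>x. gaussian (\<sigma> *\<^sub>R x) * hartley g x) \<eta>
      = c * (\<integral>z. g (\<eta> + \<sigma> *\<^sub>R z) * gaussian z \<partial>lborel)" for \<eta>
  proof -
    have \<gamma>c: "integrable lborel (\<lambda>x. gaussian (\<sigma> *\<^sub>R x) * cas (\<eta> \<bullet> x))"
      by (rule hartley_integrand_integrable[OF \<gamma>])
    have "hartley (\<lambda>x. gaussian (\<sigma> *\<^sub>R x) * hartley g x) \<eta>
        = (\<integral>x. (gaussian (\<sigma> *\<^sub>R x) * cas (\<eta> \<bullet> x)) * (\<integral>\<xi>. g \<xi> * cas (x \<bullet> \<xi>) \<partial>lborel) \<partial>lborel)"
      unfolding hartley_def by (simp add: mult_ac)
    also have "\<dots> = (\<integral>\<xi>. g \<xi> * (\<integral>x. (gaussian (\<sigma> *\<^sub>R x) * cas (\<eta> \<bullet> x)) * cas (x \<bullet> \<xi>) \<partial>lborel) \<partial>lborel)"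
      by (rule Fubini_bounded_kernel[OF \<gamma>c gi _ abs_cas_le]) measurable
    \<comment> \<open>The factor \<open>\<sigma> ^ DIM('a)\<close> prepares for
      \<open>gaussian_scale_cas\<close>; the Jacobian of the substitution \<xi> = \<eta> + \<sigma>
      z returns it, and it cancels.\<close>
    finally have "\<sigma> ^ DIM('a) * hartley (\<lambda>x. gaussian (\<sigma> *\<^sub>R x) * hartley g x) \<eta>
        = (\<integral>\<xi>. g \<xi> * (\<sigma> ^ DIM('a) * (\<integral>x. gaussian (\<sigma> *\<^sub>R x) * cas (x \<bullet> \<eta>) * cas (x \<bullet> \<xi>) \<partial>lborel)) \<partial>lborel)"
      by (simp add: inner_commute mult.left_commute del: integral_mult_left_zero flip: integral_mult_right_zero)
    also have "\<dots> = c * (\<integral>\<xi>. g \<xi> * gaussian ((\<eta> - \<xi>) /\<^sub>R \<sigma>) \<partial>lborel)"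
      unfolding gaussian_scale_cas[OF \<sigma>] c_def
      by (simp add: mult_ac del: integral_mult_left_zero flip: integral_mult_right_zero)
    also have "(\<integral>\<xi>. g \<xi> * gaussian ((\<eta> - \<xi>) /\<^sub>R \<sigma>) \<partial>lborel)
        = \<sigma> ^ DIM('a) * (\<integral>z. g (\<eta> + \<sigma> *\<^sub>R z) * gaussian z \<partial>lborel)"
      using \<sigma> by (subst integral_lborel_affine[of _ \<sigma> \<eta>]) (auto simp: gaussian_def)
    finally show ?thesis using \<sigma> by simp
  qed
  have "(\<integral>x. gaussian (\<sigma> *\<^sub>R x) * (hartley g x)\<^sup>2 \<partial>lborel)
      = (\<integral>x. hartley g x * (gaussian (\<sigma> *\<^sub>R x) * hartley g x) \<partial>lborel)"
    by (simp add: power2_eq_square mult_ac)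
  also have "\<dots> = (\<integral>\<eta>. g \<eta> * (c * (\<integral>z. g (\<eta> + \<sigma> *\<^sub>R z) * gaussian z \<partial>lborel)) \<partial>lborel)"
    unfolding integral_hartley_swap[OF gi \<gamma>h] inner ..
  also have "\<dots> = c * (\<integral>\<eta>. g \<eta> * (\<integral>z. g (\<eta> + \<sigma> *\<^sub>R z) * gaussian z \<partial>lborel) \<partial>lborel)"
    by (simp add: mult_ac del: integral_mult_left_zero flip: integral_mult_right_zero)
  finally show "(\<integral>x. gaussian (\<sigma> *\<^sub>R x) * (hartley g x)\<^sup>2 \<partial>lborel)
     = sqrt (2 * pi) ^ DIM('a) * (\<integral>\<eta>. g \<eta> * (\<integral>z. g (\<eta> + \<sigma> *\<^sub>R z) * gaussian z \<partial>lborel) \<partial>lborel)"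
    by (simp add: c_def)
qed

text \<open>Let \<sigma> tend to 0 in the regularised identity. On the right, continuity of
  \<open>g\<close> and dominated convergence give the limit. On the left, square integrability of
  \<open>hartley g\<close> is not known beforehand, but the weights increase to 1, so monotone
  convergence yields integrability and value together. One factor \<open>c\<close> comes from the
  regularised identity, the other from the mass of the Gaussian.\<close>

theorem hartley_Plancherel:
  fixes g :: "'a::euclidean_space \<Rightarrow> real"
  assumes g: "Cc g"
  shows "integrable lborel (\<lambda>x. (hartley g x)\<^sup>2)"
    and "(\<integral>x. (hartley g x)\<^sup>2 \<partial>lborel) = (2 * pi) ^ DIM('a) * (\<integral>\<xi>. (g \<xi>)\<^sup>2 \<partial>lborel)"
proof -
  define c where "c = sqrt (2 * pi) ^ DIM('a)"
  have cc: "c * c = (2 * pi) ^ DIM('a)"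
    unfolding c_def power_mult_distrib[symmetric] by auto
  define r where "r n = 1 / real (Suc n)" for n
  have r: "r n > 0" for n by (simp add: r_def)
  have r0: "r \<longlonglongrightarrow> 0"
    unfolding r_def using LIMSEQ_inverse_real_of_nat by (simp add: inverse_eq_divide)
  have [measurable]: "g \<in> borel_measurable borel" by (rule Cc_measurable[OF g])
  have gi: "integrable lborel g" by (rule Cc_integrable[OF g])
  obtain M where M: "M > 0" "\<And>x. \<bar>g x\<bar> \<le> M" using Cc_bounded[OF g] by blast
  have gcont: "(\<lambda>n. g (f n)) \<longlonglongrightarrow> g l" if "f \<longlonglongrightarrow> l" for f l
    by (rule continuous_on_tendsto_compose[OF Cc_continuous[OF g] that]) auto
  define J where "J n \<eta> = (\<integral>z. g (\<eta> + r n *\<^sub>R z) * gaussian z \<partial>lborel)" for n \<eta>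
  have J_lim: "(\<lambda>n. J n \<eta>) \<longlonglongrightarrow> c * g \<eta>" for \<eta>
  proof -
    have "(\<lambda>n. J n \<eta>) \<longlonglongrightarrow> (\<integral>z. g \<eta> * gaussian (z::'a) \<partial>lborel)"
      unfolding J_def
    proof (rule integral_dominated_convergence)
      show "integrable lborel (\<lambda>z::'a. M * gaussian z)"
        by (intro integrable_mult_right gaussian_integrable)
      show "AE z in lborel. (\<lambda>n. g (\<eta> + r n *\<^sub>R z) * gaussian z) \<longlonglongrightarrow> g \<eta> * gaussian z"
      proof (intro AE_I2 tendsto_intros gcont)
        fix z :: 'a
        have "(\<lambda>n. \<eta> + r n *\<^sub>R z) \<longlonglongrightarrow> \<eta> + 0 *\<^sub>R z"
          by (intro tendsto_intros r0)
        then show "(\<lambda>n. \<eta> + r n *\<^sub>R z) \<longlonglongrightarrow> \<eta>" by simp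
      qed
      show "AE z in lborel. norm (g (\<eta> + r n *\<^sub>R z) * gaussian z) \<le> M * gaussian z" for n
        using M by (auto simp: abs_mult gaussian_def intro!: mult_right_mono)
    qed measurable
    then show ?thesis
      by (simp add: gaussian_integral c_def mult.commute)
  qed
  have J_bound: "\<bar>J n \<eta>\<bar> \<le> M * c" for n \<eta>
  proof -
    have "\<bar>J n \<eta>\<bar> \<le> (\<integral>z. \<bar>g (\<eta> + r n *\<^sub>R z) * gaussian z\<bar> \<partial>lborel)"
      unfolding J_def by (rule integral_abs_bound)
    also have "\<dots> \<le> (\<integral>z. M * gaussian (z::'a) \<partial>lborel)"
      using M by (intro integral_mono integrable_abs gaussian_shift_integrable[OF g] integrable_mult_right gaussian_integrable)
         (auto simp: abs_mult gaussian_def intro!: mult_right_mono)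
    finally show ?thesis by (simp add: gaussian_integral c_def)
  qed
  have lim: "(\<lambda>n. \<integral>\<eta>. g \<eta> * J n \<eta> \<partial>lborel) \<longlonglongrightarrow> (\<integral>\<eta>. g \<eta> * (c * g \<eta>) \<partial>lborel)"
  proof (rule integral_dominated_convergence)
    show "integrable lborel (\<lambda>\<eta>. (M * c) * \<bar>g \<eta>\<bar>)"
      using gi by simp
    show "AE \<eta> in lborel. (\<lambda>n. g \<eta> * J n \<eta>) \<longlonglongrightarrow> g \<eta> * (c * g \<eta>)"
      by (intro AE_I2 tendsto_intros J_lim)
    show "AE \<eta> in lborel. norm (g \<eta> * J n \<eta>) \<le> (M * c) * \<bar>g \<eta>\<bar>" for n
      using J_bound by (intro AE_I2) (simp add: abs_mult mult.commute mult_left_mono)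
    show "(\<lambda>\<eta>. g \<eta> * J n \<eta>) \<in> borel_measurable lborel" for n
      unfolding J_def by measurable
  qed measurable
  have ilim: "(\<lambda>n. \<integral>x. gaussian (r n *\<^sub>R x) * (hartley g x)\<^sup>2 \<partial>lborel)
      \<longlonglongrightarrow> (2 * pi) ^ DIM('a) * (\<integral>\<xi>. (g \<xi>)\<^sup>2 \<partial>lborel)"
    unfolding hartley_gaussian_regularised(2)[OF g r]
  proof -
    have "(\<lambda>n. c * (\<integral>\<eta>. g \<eta> * J n \<eta> \<partial>lborel)) \<longlonglongrightarrow> c * (\<integral>\<eta>. g \<eta> * (c * g \<eta>) \<partial>lborel)"
      by (intro tendsto_intros lim)
    also have "c * (\<integral>\<eta>. g \<eta> * (c * g \<eta>) \<partial>lborel) = (2 * pi) ^ DIM('a) * (\<integral>\<xi>. (g \<xi>)\<^sup>2 \<partial>lborel)"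
      unfolding cc[symmetric] mult.left_commute[of "g _"] integral_mult_right_zero
      by (simp add: power2_eq_square)
    finally show "(\<lambda>n. sqrt (2 * pi) ^ DIM('a) * (\<integral>\<eta>. g \<eta> * (\<integral>z. g (\<eta> + r n *\<^sub>R z) * gaussian z \<partial>lborel) \<partial>lborel))
      \<longlonglongrightarrow> (2 * pi) ^ DIM('a) * (\<integral>\<xi>. (g \<xi>)\<^sup>2 \<partial>lborel)"
      by (simp add: c_def J_def)
  qed
  have mono: "AE x in lborel. mono (\<lambda>n. gaussian (r n *\<^sub>R x) * (hartley g x)\<^sup>2)"
  proof (intro AE_I2 monoI mult_right_mono)
    fix x :: 'a and m n :: nat assume "m \<le> n"
    then have "r n \<le> r m" by (simp add: r_def frac_le)
    then have "r n * norm x \<le> r m * norm x" by (intro mult_right_mono) auto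
    then have "(r n * norm x)\<^sup>2 \<le> (r m * norm x)\<^sup>2"
      using r[of n] by (intro power_mono) auto
    then show "gaussian (r m *\<^sub>R x) \<le> gaussian (r n *\<^sub>R x)"
      by (simp add: gaussian_def power_mult_distrib)
  qed auto
  have pw: "AE x in lborel. (\<lambda>n. gaussian (r n *\<^sub>R x) * (hartley g x)\<^sup>2) \<longlonglongrightarrow> (hartley g x)\<^sup>2"
  proof (intro AE_I2)
    fix x :: 'a
    have "(\<lambda>n. gaussian (r n *\<^sub>R x) * (hartley g x)\<^sup>2) \<longlonglongrightarrow> exp (- (norm (0 *\<^sub>R x))\<^sup>2 / 2) * (hartley g x)\<^sup>2"
      unfolding gaussian_def by (intro tendsto_intros r0) auto
    then show "(\<lambda>n. gaussian (r n *\<^sub>R x) * (hartley g x)\<^sup>2) \<longlonglongrightarrow> (hartley g x)\<^sup>2" by simp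
  qed
  note res = integral_monotone_convergence_nonneg[OF hartley_gaussian_regularised(1)[OF g r] mono _ pw ilim]
  show "integrable lborel (\<lambda>x. (hartley g x)\<^sup>2)"
    by (rule res(1)) (auto simp: gaussian_def)
  show "(\<integral>x. (hartley g x)\<^sup>2 \<partial>lborel) = (2 * pi) ^ DIM('a) * (\<integral>\<xi>. (g \<xi>)\<^sup>2 \<partial>lborel)"
    by (rule res(2)) (auto simp: gaussian_def)
qed

section \<open>Weak derivatives of Hartley transforms\<close>

lemma pdl_snoc: "pdl is (pd k \<psi>) = pdl (is @ [k]) \<psi>"
  by (induction "is") auto

lemma pd_DERIV:
  assumes "f differentiable (at (x + s *\<^sub>R axis k 1))"
  shows "((\<lambda>s. f (x + s *\<^sub>R axis k 1)) has_real_derivative pd k f (x + s *\<^sub>R axis k 1)) (at s)"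
proof -
  have "(\<lambda>h. f ((x + s *\<^sub>R axis k 1) + h *\<^sub>R axis k 1)) differentiable (at 0)"
    using assms by (intro differentiable_chain_at[of "\<lambda>h. (x + s *\<^sub>R axis k 1) + h *\<^sub>R axis k 1" 0 f, unfolded o_def]) auto
  then have "((\<lambda>h. f ((x + s *\<^sub>R axis k 1) + h *\<^sub>R axis k 1)) has_real_derivative pd k f (x + s *\<^sub>R axis k 1)) (at 0)"
    unfolding pd_def by (metis DERIV_deriv_iff_real_differentiable)
  then have "((\<lambda>h. f (x + (h + s) *\<^sub>R axis k 1)) has_real_derivative pd k f (x + s *\<^sub>R axis k 1)) (at 0)"
    by (simp add: algebra_simps)
  then show ?thesis
    using DERIV_shift[of "\<lambda>s. f (x + s *\<^sub>R axis k 1)" _ 0 s] by simp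
qed

text \<open>Outside the closed support the function vanishes on a whole ball, so its difference
  quotients vanish too and the support does not grow. Smoothness is inherited because iterated
  derivatives of \<open>pd k \<psi>\<close> are iterated derivatives of \<psi>.\<close>

lemma test_fn_pd:
  assumes "test_fn \<psi>" shows "test_fn (pd k \<psi>)"
proof -
  let ?S = "closure {x. \<psi> x \<noteq> 0}"
  have "pd k \<psi> x = 0" if "x \<notin> ?S" for x
  proof -
    have "open (- ?S)" "x \<in> - ?S" using that by (auto intro: open_Compl closed_closure)
    then have "\<exists>e>0. ball x e \<subseteq> - ?S" unfolding open_contains_ball by (rule bspec)
    then obtain e where e: "e > 0" "ball x e \<subseteq> - ?S" by (elim exE conjE)
    have "\<psi> (x + s *\<^sub>R axis k 1) = 0" if "\<bar>s\<bar> < e" for s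
    proof -
      have "x + s *\<^sub>R axis k 1 \<in> ball x e" using that by (simp add: dist_norm)
      then have "x + s *\<^sub>R axis k 1 \<notin> ?S" using e(2) by blast
      then show ?thesis using subsetD[OF closure_subset, of _ "{x. \<psi> x \<noteq> 0}"] by blast
    qed
    then have "eventually (\<lambda>s. \<psi> (x + s *\<^sub>R axis k 1) = 0) (nhds 0)"
      using e(1) by (auto simp: eventually_nhds_metric dist_real_def)
    then have "deriv (\<lambda>s. \<psi> (x + s *\<^sub>R axis k 1)) 0 = deriv (\<lambda>_. 0) 0"
      by (intro deriv_cong_ev) auto
    then show ?thesis by (simp add: pd_def)
  qed
  then have "{x. pd k \<psi> x \<noteq> 0} \<subseteq> ?S" by blast
  then have "closure {x. pd k \<psi> x \<noteq> 0} \<subseteq> ?S" by (simp add: closure_minimal)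
  moreover have "compact (?S \<inter> closure {x. pd k \<psi> x \<noteq> 0})"
    using assms by (intro compact_Int_closed) (simp_all add: test_fn_def)
  ultimately have "compact (closure {x. pd k \<psi> x \<noteq> 0})"
    by (simp add: inf.absorb2)
  then show ?thesis
    using assms by (auto simp: test_fn_def smooth_fn_def pdl_snoc)
qed

lemma test_fn_pdl: "test_fn \<psi> \<Longrightarrow> test_fn (pdl is \<psi>)"
  by (induction "is") (auto intro: test_fn_pd)

lemma test_fn_differentiable: "test_fn \<psi> \<Longrightarrow> \<psi> differentiable (at x)"
  unfolding test_fn_def smooth_fn_def by (metis pdl.simps(1))

lemma test_fn_Cc:
  assumes "test_fn \<psi>" shows "Cc \<psi>"
proof -
  have "continuous_on UNIV \<psi>"
    using test_fn_differentiable[OF assms]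
    by (simp add: continuous_at_imp_continuous_on differentiable_imp_continuous_within)
  moreover obtain R where R: "closure {x. \<psi> x \<noteq> 0} \<subseteq> cball 0 R"
    using assms bounded_subset_ballD[OF compact_imp_bounded, of "closure {x. \<psi> x \<noteq> 0}" 0] ball_subset_cball
    unfolding test_fn_def by blast
  have "\<psi> x = 0" if "norm x > R" for x
  proof (rule ccontr)
    assume "\<psi> x \<noteq> 0"
    then have "x \<in> cball 0 R" using R subsetD[OF closure_subset, of x "{x. \<psi> x \<noteq> 0}"] by blast
    then show False using that by simp
  qed
  ultimately show ?thesis by (auto simp: Cc_def)
qed

lemma cas_DERIV: "(cas has_real_derivative cas (- \<theta>)) (at \<theta>)"
  unfolding cas_def[abs_def] by (auto intro!: derivative_eq_intros)

lemma cas_lipschitz: "\<bar>cas a - cas b\<bar> \<le> 2 * \<bar>a - b\<bar>"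
  using field_differentiable_bound[of UNIV cas "\<lambda>\<theta>. cas (- \<theta>)" 2 a b] cas_DERIV abs_cas_le by simp

text \<open>Translation invariance replaces integration by parts: a difference quotient of \<psi>
  against the kernel equals \<psi> against a difference quotient of the kernel. Both sides converge
  by dominated convergence as the step tends to 0.\<close>

lemma hartley_pd:
  assumes \<psi>: "test_fn \<psi>"
  shows "hartley (pd k \<psi>) \<xi> = - \<xi> $ k * hartley \<psi> (- \<xi>)"
proof -
  let ?e = "axis k 1 :: R3"
  define r where "r n = 1 / real (Suc n)" for n
  have r: "r n > 0" "r n \<le> 1" for n by (simp_all add: r_def)
  have r0: "r \<longlonglongrightarrow> 0"
    unfolding r_def using LIMSEQ_inverse_real_of_nat by (simp add: inverse_eq_divide)
  then have rat: "filterlim r (at 0) sequentially"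
    using r by (auto simp: filterlim_at less_imp_neq[symmetric])
  have C: "Cc \<psi>" and C': "Cc (pd k \<psi>)"
    using \<psi> test_fn_pd test_fn_Cc by auto
  have [measurable]: "\<psi> \<in> borel_measurable borel" "pd k \<psi> \<in> borel_measurable borel"
    using C C' Cc_measurable by auto
  obtain R where R: "\<And>x. norm x > R \<Longrightarrow> \<psi> x = 0" using C by (auto simp: Cc_def)
  obtain M where M: "M > 0" "\<And>x. \<bar>pd k \<psi> x\<bar> \<le> M" using Cc_bounded[OF C'] by blast
  define D where "D n x = (\<psi> (x + r n *\<^sub>R ?e) - \<psi> x) / r n" for n x
  have "(\<lambda>n. \<integral>x. D n x * cas (\<xi> \<bullet> x) \<partial>lborel) \<longlonglongrightarrow> hartley (pd k \<psi>) \<xi>"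
    unfolding hartley_def
  proof (rule integral_dominated_convergence)
    \<comment> \<open>Steps are at most 1, so the quotients vanish outside the ball of radius
      \<open>R + 1\<close>; \<open>M\<close> bounds them by the mean value theorem, and 2 bounds
      \<open>cas\<close>.\<close>
    show "integrable lborel (\<lambda>x. 2 * M * indicator (cball 0 (R + 1)) (x :: R3) :: real)"
      by (intro integrable_mult_right integrable_real_indicator) (use emeasure_lborel_cball_finite in auto)
    show "(\<lambda>x. D n x * cas (\<xi> \<bullet> x)) \<in> borel_measurable lborel" for n
      unfolding D_def by measurable
    show "AE x in lborel. (\<lambda>n. D n x * cas (\<xi> \<bullet> x)) \<longlonglongrightarrow> pd k \<psi> x * cas (\<xi> \<bullet> x)"
    proof (intro AE_I2 tendsto_intros)
      fix x
      have "((\<lambda>s. \<psi> (x + s *\<^sub>R ?e)) has_real_derivative pd k \<psi> x) (at 0)"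
        using pd_DERIV[OF test_fn_differentiable[OF \<psi>], where x = x and s = 0 and k = k] by simp
      then have "((\<lambda>s. (\<psi> (x + s *\<^sub>R ?e) - \<psi> x) / s) \<longlongrightarrow> pd k \<psi> x) (at 0)"
        by (simp add: has_field_derivative_iff)
      from filterlim_compose[OF this rat] show "(\<lambda>n. D n x) \<longlonglongrightarrow> pd k \<psi> x"
        by (simp add: D_def)
    qed
    show "AE x in lborel. norm (D n x * cas (\<xi> \<bullet> x)) \<le> 2 * M * indicator (cball 0 (R + 1)) x" for n
    proof (intro AE_I2)
      fix x
      have "norm (\<psi> (x + r n *\<^sub>R ?e) - \<psi> (x + 0 *\<^sub>R ?e)) \<le> M * norm (r n - 0)"
        by (rule field_differentiable_bound[of UNIV])
           (use M pd_DERIV[OF test_fn_differentiable[OF \<psi>]] in auto)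
      then have DM: "\<bar>D n x\<bar> \<le> M"
        using r[of n] by (simp add: D_def abs_divide divide_le_eq)
      show "norm (D n x * cas (\<xi> \<bullet> x)) \<le> 2 * M * indicator (cball 0 (R + 1)) x"
      proof (cases "norm x \<le> R + 1")
        case True
        then show ?thesis using abs_mult_cas_le[of "D n x" "\<xi> \<bullet> x"] DM by simp
      next
        case False
        have "norm x \<le> norm (x + r n *\<^sub>R ?e) + norm (r n *\<^sub>R ?e)"
          using norm_triangle_ineq4[of "x + r n *\<^sub>R ?e" "r n *\<^sub>R ?e"] by simp
        then have "norm (x + r n *\<^sub>R ?e) > R" "norm x > R"
          using False r[of n] by auto
        then show ?thesis using False R by (simp add: D_def)
      qed
    qed
  qed measurable
  moreover have "(\<integral>x. D n x * cas (\<xi> \<bullet> x) \<partial>lborel)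
      = (\<integral>x. \<psi> x * ((cas (\<xi> \<bullet> x - r n * \<xi> $ k) - cas (\<xi> \<bullet> x)) / r n) \<partial>lborel)" for n
  proof -
    have i: "integrable lborel (\<lambda>x. \<psi> x * cas (\<xi> \<bullet> x))"
      by (rule hartley_integrand_integrable[OF Cc_integrable[OF C]])
    have "integrable lborel (\<lambda>x. \<psi> (r n *\<^sub>R ?e + 1 *\<^sub>R x))"
      by (rule integrable_lborel_affine[OF Cc_integrable[OF C]]) simp
    then have i1: "integrable lborel (\<lambda>x. \<psi> (x + r n *\<^sub>R ?e) * cas (\<xi> \<bullet> x))"
      by (intro hartley_integrand_integrable) (simp add: add.commute)
    have m: "(\<lambda>x. \<psi> x * cas (\<xi> \<bullet> x - r n * \<xi> $ k)) \<in> borel_measurable borel" by measurable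
    have sh: "\<xi> \<bullet> (r n *\<^sub>R ?e + x) - r n * \<xi> $ k = \<xi> \<bullet> x" for x
      by (simp add: inner_add_right inner_axis)
    have e1: "(\<integral>x. \<psi> (x + r n *\<^sub>R ?e) * cas (\<xi> \<bullet> x) \<partial>lborel) = (\<integral>x. \<psi> x * cas (\<xi> \<bullet> x - r n * \<xi> $ k) \<partial>lborel)"
      using integral_translate_lborel[OF m, of "r n *\<^sub>R ?e"] by (simp only: sh) (simp add: add.commute)
    have i2: "integrable lborel (\<lambda>x. \<psi> x * cas (\<xi> \<bullet> x - r n * \<xi> $ k))"
    proof (rule Bochner_Integration.integrable_bound)
      show "integrable lborel (\<lambda>x. 2 * \<psi> x)" using Cc_integrable[OF C] by simp
      show "AE x in lborel. norm (\<psi> x * cas (\<xi> \<bullet> x - r n * \<xi> $ k)) \<le> norm (2 * \<psi> x)"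
        unfolding real_norm_def abs_mult[of 2] by (intro AE_I2) (simp add: abs_mult_cas_le)
    qed measurable
    have "(\<integral>x. D n x * cas (\<xi> \<bullet> x) \<partial>lborel)
        = (\<integral>x. (\<psi> (x + r n *\<^sub>R ?e) * cas (\<xi> \<bullet> x) - \<psi> x * cas (\<xi> \<bullet> x)) / r n \<partial>lborel)"
      by (simp add: D_def algebra_simps)
    also have "\<dots> = (\<integral>x. (\<psi> x * cas (\<xi> \<bullet> x - r n * \<xi> $ k) - \<psi> x * cas (\<xi> \<bullet> x)) / r n \<partial>lborel)"
      using i i1 i2 e1 by simp
    finally show ?thesis by (simp add: algebra_simps)
  qed
  moreover have "(\<lambda>n. \<integral>x. \<psi> x * ((cas (\<xi> \<bullet> x - r n * \<xi> $ k) - cas (\<xi> \<bullet> x)) / r n) \<partial>lborel)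
      \<longlonglongrightarrow> (\<integral>x. \<psi> x * (cas (- (\<xi> \<bullet> x)) * - \<xi> $ k) \<partial>lborel)"
  proof (rule integral_dominated_convergence)
    show "integrable lborel (\<lambda>x. (2 * \<bar>\<xi> $ k\<bar>) * \<bar>\<psi> x\<bar>)"
      using Cc_integrable[OF C] by simp
    show "AE x in lborel. (\<lambda>n. \<psi> x * ((cas (\<xi> \<bullet> x - r n * \<xi> $ k) - cas (\<xi> \<bullet> x)) / r n))
        \<longlonglongrightarrow> \<psi> x * (cas (- (\<xi> \<bullet> x)) * - \<xi> $ k)"
    proof (intro AE_I2 tendsto_mult tendsto_const)
      fix x
      have "((\<lambda>s. cas (\<xi> \<bullet> x - s * \<xi> $ k)) has_real_derivative (cas (- (\<xi> \<bullet> x)) * - \<xi> $ k)) (at 0)"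
        by (rule DERIV_chain'[of "\<lambda>s. \<xi> \<bullet> x - s * \<xi> $ k" _ _ _ cas])
           (auto intro!: derivative_eq_intros DERIV_subset[OF cas_DERIV[of "\<xi> \<bullet> x"]])
      then have "((\<lambda>s. (cas (\<xi> \<bullet> x - s * \<xi> $ k) - cas (\<xi> \<bullet> x)) / s) \<longlongrightarrow> cas (- (\<xi> \<bullet> x)) * - \<xi> $ k) (at 0)"
        by (simp add: has_field_derivative_iff)
      from filterlim_compose[OF this rat]
      show "(\<lambda>n. (cas (\<xi> \<bullet> x - r n * \<xi> $ k) - cas (\<xi> \<bullet> x)) / r n) \<longlonglongrightarrow> cas (- (\<xi> \<bullet> x)) * - \<xi> $ k" .
    qed
    show "AE x in lborel. norm (\<psi> x * ((cas (\<xi> \<bullet> x - r n * \<xi> $ k) - cas (\<xi> \<bullet> x)) / r n)) \<le> (2 * \<bar>\<xi> $ k\<bar>) * \<bar>\<psi> x\<bar>" for n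
    proof (intro AE_I2)
      fix x
      have "\<bar>(cas (\<xi> \<bullet> x - r n * \<xi> $ k) - cas (\<xi> \<bullet> x)) / r n\<bar> \<le> 2 * \<bar>\<xi> $ k\<bar>"
        using cas_lipschitz[of "\<xi> \<bullet> x - r n * \<xi> $ k" "\<xi> \<bullet> x"] r[of n]
        by (simp add: abs_divide abs_mult divide_le_eq mult_ac)
      from mult_left_mono[OF this abs_ge_zero[of "\<psi> x"]]
      show "norm (\<psi> x * ((cas (\<xi> \<bullet> x - r n * \<xi> $ k) - cas (\<xi> \<bullet> x)) / r n)) \<le> (2 * \<bar>\<xi> $ k\<bar>) * \<bar>\<psi> x\<bar>"
        unfolding real_norm_def abs_mult[of "\<psi> x"] by (simp only: mult.commute)
    qed
  qed measurable
  ultimately have "hartley (pd k \<psi>) \<xi> = (\<integral>x. \<psi> x * (cas (- (\<xi> \<bullet> x)) * - \<xi> $ k) \<partial>lborel)"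
    using LIMSEQ_unique by simp
  also have "\<dots> = (\<integral>x. - \<xi> $ k * (\<psi> x * cas (- \<xi> \<bullet> x)) \<partial>lborel)"
    by (simp add: mult_ac)
  also have "\<dots> = - \<xi> $ k * hartley \<psi> (- \<xi>)"
    unfolding hartley_def by (rule integral_mult_right_zero)
  finally show ?thesis .
qed

text \<open>The symbol of \<open>\<partial>\<^sub>k\<close>; the reflection appears because the derivative of \<open>cas \<theta>\<close> is \<open>cas (- \<theta>)\<close>.\<close>

definition mdiff :: "3 \<Rightarrow> (R3 \<Rightarrow> real) \<Rightarrow> R3 \<Rightarrow> real" where
  "mdiff k g \<xi> = - \<xi> $ k * g (- \<xi>)"

text \<open>The head of the list acts first here, while \<open>pdl\<close> applies it last:
  transferring derivatives from \<psi> to \<open>g\<close> strips the outermost one first.\<close>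

fun mdiffs :: "3 list \<Rightarrow> (R3 \<Rightarrow> real) \<Rightarrow> R3 \<Rightarrow> real" where
  "mdiffs [] g = g"
| "mdiffs (i # is) g = mdiffs is (mdiff i g)"

lemma Cc_mdiff: "Cc g \<Longrightarrow> Cc (mdiff k g)"
  unfolding mdiff_def[abs_def] by (intro Cc_mult Cc_reflect) (auto intro!: continuous_intros)

lemma Cc_mdiffs: "Cc g \<Longrightarrow> Cc (mdiffs is g)"
  by (induction "is" arbitrary: g) (auto intro: Cc_mdiff)

lemma integral_hartley_test:
  assumes "Cc g" "test_fn \<psi>"
  shows "(\<integral>x. hartley g x * \<psi> x \<partial>lborel) = (\<integral>\<xi>. g \<xi> * hartley \<psi> \<xi> \<partial>lborel)"
  by (rule integral_hartley_swap[OF Cc_integrable[OF assms(1)] Cc_integrable[OF test_fn_Cc[OF assms(2)]]])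

text \<open>The symbol reaches the test function together with a reflection; substituting -\<xi> for
  \<xi> in the frequency integral puts both on \<open>g\<close>.\<close>

lemma integral_hartley_pd:
  assumes g: "Cc g" and \<psi>: "test_fn \<psi>"
  shows "(\<integral>x. hartley g x * pd k \<psi> x \<partial>lborel) = - (\<integral>x. hartley (mdiff k g) x * \<psi> x \<partial>lborel)"
proof -
  have [measurable]: "g \<in> borel_measurable borel" "\<psi> \<in> borel_measurable borel"
    using Cc_measurable[OF g] Cc_measurable[OF test_fn_Cc[OF \<psi>]] by auto
  have m: "(\<lambda>\<xi>. g \<xi> * (- \<xi> $ k * hartley \<psi> (- \<xi>))) \<in> borel_measurable borel"
    by measurable
  have "(\<integral>x. hartley g x * pd k \<psi> x \<partial>lborel) = (\<integral>\<xi>. g \<xi> * (- \<xi> $ k * hartley \<psi> (- \<xi>)) \<partial>lborel)"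
    using integral_hartley_test[OF g test_fn_pd[OF \<psi>]] by (simp add: hartley_pd[OF \<psi>])
  also have "\<dots> = (\<integral>\<xi>. - (mdiff k g \<xi> * hartley \<psi> \<xi>) \<partial>lborel)"
    by (subst integral_reflect_lborel[OF m, symmetric]) (simp add: mdiff_def mult_ac)
  also have "\<dots> = - (\<integral>x. hartley (mdiff k g) x * \<psi> x \<partial>lborel)"
    using integral_hartley_test[OF Cc_mdiff[OF g] \<psi>] by simp
  finally show ?thesis .
qed

lemma integral_hartley_pdl:
  assumes "Cc g" and \<psi>: "test_fn \<psi>"
  shows "(\<integral>x. hartley g x * pdl is \<psi> x \<partial>lborel)
    = (-1) ^ length is * (\<integral>x. hartley (mdiffs is g) x * \<psi> x \<partial>lborel)"
  using assms(1)
proof (induction "is" arbitrary: g)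
  case (Cons i "is")
  then show ?case
    using integral_hartley_pd[OF Cons.prems test_fn_pdl[OF \<psi>]] Cons.IH[OF Cc_mdiff[OF Cons.prems]] by simp
qed simp

lemma weak_deriv_hartley: "Cc g \<Longrightarrow> weak_deriv is (hartley g) (hartley (mdiffs is g))"
  unfolding weak_deriv_def using integral_hartley_pdl by blast

lemma memL2_hartley: "Cc g \<Longrightarrow> memL2 (hartley g)"
  unfolding memL2_def using hartley_Plancherel(1) hartley_measurable Cc_measurable by fastforce

lemma H3_hartley: "Cc g \<Longrightarrow> H3 (hartley g)"
  unfolding H3_def using memL2_hartley weak_deriv_hartley Cc_mdiffs by blast

lemma L2norm_hartley: "Cc g \<Longrightarrow> (L2norm (hartley g))\<^sup>2 = (2 * pi) ^ 3 * (\<integral>\<xi>. (g \<xi>)\<^sup>2 \<partial>lborel)"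
  unfolding L2norm_def by (simp add: hartley_Plancherel(2))

section \<open>Uniqueness of weak derivatives\<close>

definition flat :: "real poly \<Rightarrow> real \<Rightarrow> real" where
  "flat p y = (if y > 0 then poly p (1 / y) * exp (- (1 / y)) else 0)"

lemma poly_exp_tendsto_0: "((\<lambda>z::real. poly p z * exp (- z)) \<longlongrightarrow> 0) at_top"
proof -
  have "((\<lambda>z::real. \<Sum>i\<le>degree p. coeff p i * (z ^ i / exp z)) \<longlongrightarrow> (\<Sum>i\<le>degree p. coeff p i * 0)) at_top"
    by (intro tendsto_sum tendsto_mult tendsto_const tendsto_power_div_exp_0)
  moreover have "(\<lambda>z::real. \<Sum>i\<le>degree p. coeff p i * (z ^ i / exp z)) = (\<lambda>z. poly p z * exp (- z))"
    by (simp add: fun_eq_iff poly_altdef sum_distrib_left exp_minus divide_inverse mult_ac)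
  ultimately show ?thesis by simp
qed

text \<open>With z = 1 / y, differentiating p(z) exp(-z) in y gives \<open>z\<^sup>2\<close> (p(z) -
  p'(z)) exp(-z), which is again of the same form. The family is therefore closed under
  differentiation, also across the flat point 0.\<close>

lemma flat_DERIV: "(flat p has_real_derivative flat ([:0, 0, 1:] * (p - pderiv p)) y) (at y)"
proof -
  consider "y > 0" | "y < 0" | "y = 0" by linarith
  then show ?thesis
  proof cases
    case 1
    have "((\<lambda>y. poly p (1 / y) * exp (- (1 / y))) has_real_derivative flat ([:0, 0, 1:] * (p - pderiv p)) y) (at y)"
      using 1 by (auto intro!: derivative_eq_intros poly_DERIV[THEN DERIV_chain2]
          simp: flat_def field_simps power2_eq_square)
    moreover have "eventually (\<lambda>y. flat p y = poly p (1 / y) * exp (- (1 / y))) (nhds y)"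
      using eventually_nhds_in_open[of "{0<..}" y] 1 by (auto elim: eventually_mono simp: flat_def)
    ultimately show ?thesis by (subst DERIV_cong_ev) auto
  next
    case 2
    have "eventually (\<lambda>y. flat p y = 0) (nhds y)"
      using eventually_nhds_in_open[of "{..<0}" y] 2 by (auto elim: eventually_mono simp: flat_def)
    then show ?thesis using 2 by (subst DERIV_cong_ev[where g = "\<lambda>_. 0"]) (auto simp: flat_def)
  next
    case 3
    \<comment> \<open>Division by h is one more factor z = 1 / h, hence the polynomial
      \<open>[:0, 1:] * p\<close>, and exp(-z) beats every polynomial as z tends to
      infinity.\<close>
    have "((\<lambda>h. flat p h / h) \<longlongrightarrow> 0) (at_right 0)"
    proof (rule Lim_transform_eventually)
      show "((\<lambda>h. poly ([:0, 1:] * p) (inverse h) * exp (- inverse h)) \<longlongrightarrow> 0) (at_right (0::real))"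
        by (rule filterlim_compose[OF poly_exp_tendsto_0 filterlim_inverse_at_top_right])
      show "\<forall>\<^sub>F h in at_right 0. poly ([:0, 1:] * p) (inverse h) * exp (- inverse h) = flat p h / h"
        by (rule eventually_mono[OF eventually_at_right_less[of 0]]) (simp add: flat_def field_simps)
    qed
    moreover have "((\<lambda>h. flat p h / h) \<longlongrightarrow> 0) (at_left 0)"
    proof (rule Lim_transform_eventually)
      show "((\<lambda>_. 0) \<longlongrightarrow> 0) (at_left (0::real))" by simp
      show "\<forall>\<^sub>F h in at_left 0. 0 = flat p h / h"
        by (auto simp: eventually_at_left_field flat_def intro: exI[of _ "-1"])
    qed
    ultimately have "((\<lambda>h. flat p h / h) \<longlongrightarrow> 0) (at 0)"
      by (simp add: filterlim_split_at_real)
    then show ?thesis using 3 by (simp add: has_field_derivative_iff flat_def)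
  qed
qed

text \<open>A set of functions closed under differentiation, so that its members are smooth.\<close>

inductive flatalg :: "(real \<Rightarrow> real) \<Rightarrow> bool" where
  base: "flatalg (\<lambda>t. flat p (c * t + d))"
| add: "flatalg f \<Longrightarrow> flatalg g \<Longrightarrow> flatalg (\<lambda>t. f t + g t)"
| mult: "flatalg f \<Longrightarrow> flatalg g \<Longrightarrow> flatalg (\<lambda>t. f t * g t)"

lemma flatalg_DERIV:
  assumes "flatalg f" obtains f' where "flatalg f'" "\<And>t. (f has_real_derivative f' t) (at t)"
  using assms
proof (induction arbitrary: thesis)
  case (base p c d)
  let ?q = "smult c ([:0, 0, 1:] * (p - pderiv p))"
  have "((\<lambda>t. flat p (c * t + d)) has_real_derivative flat ?q (c * t + d)) (at t)" for t
  proof -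
    have "((\<lambda>t. flat p (c * t + d)) has_real_derivative flat ([:0, 0, 1:] * (p - pderiv p)) (c * t + d) * c) (at t)"
      by (rule DERIV_chain2[OF flat_DERIV]) (auto intro!: derivative_eq_intros)
    also have "flat ([:0, 0, 1:] * (p - pderiv p)) (c * t + d) * c = flat ?q (c * t + d)"
      unfolding flat_def poly_smult by simp
    finally show ?thesis .
  qed
  then show ?case using base flatalg.base by blast
next
  case (add f g)
  obtain f' g' where "flatalg f'" "flatalg g'"
    and "\<And>t. (f has_real_derivative f' t) (at t)" "\<And>t. (g has_real_derivative g' t) (at t)"
    using add.IH by metis
  then show ?case
    using add.prems[of "\<lambda>t. f' t + g' t"] by (auto intro: flatalg.add DERIV_add)
next
  case (mult f g)
  obtain f' g' where "flatalg f'" "flatalg g'"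
    and "\<And>t. (f has_real_derivative f' t) (at t)" "\<And>t. (g has_real_derivative g' t) (at t)"
    using mult.IH by metis
  then show ?case
    by (intro mult.prems[of "\<lambda>t. f' t * g t + g' t * f t"] flatalg.add flatalg.mult DERIV_mult mult.hyps)
qed

text \<open>In a product of one-variable functions a partial derivative changes a single factor, so
  smoothness on \<open>R3\<close> reduces to closure under differentiation on the line.\<close>

definition tensor :: "(3 \<Rightarrow> real \<Rightarrow> real) \<Rightarrow> R3 \<Rightarrow> real" where
  "tensor f x = (\<Prod>j\<in>UNIV. f j (x $ j))"

lemma tensor_differentiable:
  assumes "\<And>j. flatalg (f j)"
  shows "tensor f differentiable (at x)"
proof -
  have "(\<lambda>x. f j (x $ j)) differentiable (at x)" for j
  proof -
    obtain f' where "\<And>t. (f j has_real_derivative f' t) (at t)"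
      using flatalg_DERIV[OF assms[of j]] by metis
    then have "f j differentiable (at (x $ j))"
      by (meson real_differentiable_def)
    then show ?thesis
      using differentiable_chain_at[of "\<lambda>x. x $ j" x "f j"]
      by (simp add: o_def bounded_linear_imp_differentiable bounded_linear_vec_nth)
  qed
  then show ?thesis
    unfolding tensor_def[abs_def] UNIV_3 by (simp add: mult.assoc[symmetric] differentiable_mult)
qed

lemma pd_tensor:
  assumes f: "\<And>j. flatalg (f j)" and f': "\<And>t. (f i has_real_derivative f' t) (at t)"
  shows "pd i (tensor f) = tensor (f(i := f'))"
proof
  fix x
  define c where "c = (\<Prod>j\<in>UNIV - {i}. f j (x $ j))"
  \<comment> \<open>The factor \<open>h\<close> is left arbitrary so that the identity serves for
    the function and, at s = 0, for its derivative.\<close>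
  have eq: "tensor (f(i := h)) (x + s *\<^sub>R axis i 1) = h (x $ i + s) * c" for h s
    unfolding tensor_def c_def
    by (subst prod.remove[of _ i]) (auto intro!: prod.cong simp: axis_def)
  have "((\<lambda>s. f i (x $ i + s) * c) has_real_derivative f' (x $ i) * c) (at 0)"
    using f'[of "x $ i"] DERIV_shift[of "f i" "f' (x $ i)" 0 "x $ i"]
    by (intro DERIV_cmult_right) (simp add: add.commute)
  then have "((\<lambda>s. tensor f (x + s *\<^sub>R axis i 1)) has_real_derivative tensor (f(i := f')) x) (at 0)"
    using eq[of "f i"] eq[of f' 0] by simp
  then show "pd i (tensor f) x = tensor (f(i := f')) x"
    unfolding pd_def by (rule DERIV_imp_deriv)
qed

lemma smooth_fn_tensor:
  assumes "\<And>j. flatalg (f j)" shows "smooth_fn (tensor f)"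
proof -
  have "\<exists>g. (\<forall>j. flatalg (g j)) \<and> pdl is (tensor f) = tensor g" for "is"
  proof (induction "is")
    case Nil
    then show ?case using assms by auto
  next
    case (Cons i "is")
    then obtain g where g: "\<And>j. flatalg (g j)" "pdl is (tensor f) = tensor g" by blast
    obtain g' where g': "flatalg g'" "\<And>t. (g i has_real_derivative g' t) (at t)"
      using flatalg_DERIV[OF g(1)[of i]] by metis
    have "pdl (i # is) (tensor f) = tensor (g(i := g'))"
      using g(2) pd_tensor[of g i g', OF g(1) g'(2)] by (simp del: fun_upd_apply)
    moreover have "\<forall>j. flatalg ((g(i := g')) j)"
      using g(1) g'(1) by simp
    ultimately show ?case by blast
  qed
  then show ?thesis
    unfolding smooth_fn_def using tensor_differentiable by metis
qed

text \<open>Each factor exp(-1 / (n y)) tends to 1 for y > 0 and is 0 otherwise, so the indicator of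
  the open box is approximated from below, with support in the closed box for every n > 0. The
  arguments are expanded to the affine form of the generators of \<open>flatalg\<close>.\<close>

definition bump :: "nat \<Rightarrow> R3 \<Rightarrow> R3 \<Rightarrow> R3 \<Rightarrow> real" where
  "bump n a b = tensor (\<lambda>j t. flat 1 (real n * t + - real n * a $ j) * flat 1 (- real n * t + real n * b $ j))"

lemma flat_1: "flat 1 (real n * y) \<in> {0..1}" "n > 0 \<Longrightarrow> flat 1 (real n * y) \<noteq> 0 \<longleftrightarrow> y > 0"
  by (auto simp: flat_def zero_less_mult_iff)

lemma bump_eq: "bump n a b x = (\<Prod>j\<in>UNIV. flat 1 (real n * (x $ j - a $ j)) * flat 1 (real n * (b $ j - x $ j)))"
  unfolding bump_def tensor_def by (simp add: algebra_simps)

lemma bump_bounds: "0 \<le> bump n a b x" "bump n a b x \<le> 1"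
  unfolding bump_eq using flat_1(1)
  by (auto intro!: prod_nonneg prod_le_1 mult_nonneg_nonneg mult_le_one)

lemma bump_nonzero_iff: "n > 0 \<Longrightarrow> bump n a b x \<noteq> 0 \<longleftrightarrow> x \<in> box a b"
  unfolding bump_eq by (auto simp: flat_1(2) mem_box_cart)

lemma test_fn_bump:
  assumes "n > 0" shows "test_fn (bump n a b)"
proof -
  have "closure {x. bump n a b x \<noteq> 0} \<subseteq> cbox a b"
    using box_subset_cbox[of a b] by (intro closure_minimal) (auto simp: bump_nonzero_iff[OF assms])
  then have "compact (cbox a b \<inter> closure {x. bump n a b x \<noteq> 0})"
    by (intro compact_Int_closed) auto
  then have "compact (closure {x. bump n a b x \<noteq> 0})"
    using \<open>closure {x. bump n a b x \<noteq> 0} \<subseteq> cbox a b\<close> by (simp add: inf.absorb2)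
  moreover have "smooth_fn (bump n a b)"
    unfolding bump_def by (intro smooth_fn_tensor flatalg.intros)
  ultimately show ?thesis by (simp add: test_fn_def)
qed

lemma flat_1_tendsto:
  assumes "y > 0" shows "(\<lambda>n. flat 1 (real (Suc n) * y)) \<longlonglongrightarrow> 1"
proof -
  have "(\<lambda>n. exp (- (1 / real (Suc n) * (1 / y)))) \<longlonglongrightarrow> exp (- (0 * (1 / y)))"
    using LIMSEQ_inverse_real_of_nat by (intro tendsto_intros) (simp add: inverse_eq_divide)
  then show ?thesis using assms by (simp add: flat_def)
qed

text \<open>The index is shifted because \<open>bump 0 a b\<close> is identically 0.\<close>

lemma bump_tendsto: "(\<lambda>n. bump (Suc n) a b x) \<longlonglongrightarrow> indicator (box a b) x"
proof (cases "x \<in> box a b")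
  case True
  then have "(\<lambda>n. bump (Suc n) a b x) \<longlonglongrightarrow> (\<Prod>j\<in>(UNIV :: 3 set). 1 * 1)"
    unfolding bump_eq by (intro tendsto_prod tendsto_mult flat_1_tendsto) (auto simp: mem_box_cart)
  then show ?thesis using True by simp
next
  case False
  then have "bump (Suc n) a b x = 0" for n using bump_nonzero_iff[of "Suc n"] by blast
  then show ?thesis using False by simp
qed

section \<open>From vanishing pairings to vanishing almost everywhere\<close>

lemma AE_zero_if_box_integrals_zero:
  fixes f :: "'a::euclidean_space \<Rightarrow> real"
  assumes [measurable]: "f \<in> borel_measurable borel"
    and int: "\<And>a b. integrable lborel (\<lambda>x. indicator (box a b) x * f x)"
    and zero: "\<And>a b. (\<integral>x. indicator (box a b) x * f x \<partial>lborel) = 0"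
  shows "AE x in lborel. f x = 0"
proof -
  have em: "emeasure (density lborel (\<lambda>x. ennreal (g x))) (box a b)
      = (\<integral>\<^sup>+x. ennreal (indicator (box a b) x * g x) \<partial>lborel)"
    if [measurable]: "g \<in> borel_measurable borel" for g :: "'a \<Rightarrow> real" and a b
    by (subst emeasure_density) (auto intro!: nn_integral_cong simp: indicator_def)
  have fin: "(\<integral>\<^sup>+x. ennreal (indicator (box a b) x * f x) \<partial>lborel) \<noteq> \<infinity>"
    and fin': "(\<integral>\<^sup>+x. ennreal (- (indicator (box a b) x * f x)) \<partial>lborel) \<noteq> \<infinity>" for a b
    using int[of a b] by (auto simp: real_integrable_def)
  have inj: "s = t" if "enn2real s = enn2real t" "s \<noteq> \<infinity>" "t \<noteq> \<infinity>" for s t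
    using that by (cases s; cases t) auto
  have eq: "emeasure (density lborel (\<lambda>x. ennreal (f x))) (box a b)
      = emeasure (density lborel (\<lambda>x. ennreal (- f x))) (box a b)" for a b
  proof -
    have "enn2real (\<integral>\<^sup>+x. ennreal (indicator (box a b) x * f x) \<partial>lborel)
        = enn2real (\<integral>\<^sup>+x. ennreal (- (indicator (box a b) x * f x)) \<partial>lborel)"
      using real_lebesgue_integral_def[OF int[of a b]] zero[of a b] by simp
    then have "(\<integral>\<^sup>+x. ennreal (indicator (box a b) x * f x) \<partial>lborel)
        = (\<integral>\<^sup>+x. ennreal (- (indicator (box a b) x * f x)) \<partial>lborel)"
      by (intro inj[OF _ fin fin'])
    then show ?thesis by (simp add: em)
  qed
  let ?E = "range (\<lambda>(a, b). box a b :: 'a set)"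
  let ?A = "\<lambda>n::nat. box (- (real n *\<^sub>R One)) (real n *\<^sub>R One) :: 'a set"
  \<comment> \<open>Since \<open>ennreal\<close> sends negative numbers to 0, these are the measures
    with the positive and the negative part of \<open>f\<close> as densities. They agree and are
    finite on boxes, an intersection-stable generator of the Borel sets. Equal densities almost
    everywhere then force both parts to vanish.\<close>
  have "density lborel (\<lambda>x. ennreal (f x)) = density lborel (\<lambda>x. ennreal (- f x))"
  proof (rule measure_eqI_generator_eq)
    show "Int_stable ?E" by (auto simp: Int_stable_def box_Int_box)
    show "?E \<subseteq> Pow UNIV" by simp
    show "sets (density lborel (\<lambda>x. ennreal (f x))) = sigma_sets UNIV ?E"
      "sets (density lborel (\<lambda>x. ennreal (- f x))) = sigma_sets UNIV ?E"
      by (simp_all add: borel_eq_box)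
    show "range ?A \<subseteq> ?E" "(\<Union>i. ?A i) = UNIV" unfolding UN_box_eq_UNIV by auto
    show "emeasure (density lborel (\<lambda>x. ennreal (f x))) (?A i) \<noteq> \<infinity>" for i
      using fin by (simp add: em)
  qed (use eq in auto)
  then have "AE x in lborel. ennreal (f x) = ennreal (- f x)"
    by (intro sigma_finite_measure.density_unique sigma_finite_lborel) auto
  then show ?thesis
  proof (rule AE_mp, intro AE_I2 impI)
    fix x assume *: "ennreal (f x) = ennreal (- f x)"
    show "f x = 0"
    proof (cases "f x \<ge> 0")
      case True
      then have "ennreal (f x) = 0" using * by (simp add: ennreal_neg)
      then show ?thesis using True by (simp add: ennreal_eq_0_iff)
    next
      case False
      then have "ennreal (- f x) = 0" using * by (simp add: ennreal_neg)
      then show ?thesis using False by (simp add: ennreal_eq_0_iff)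
    qed
  qed
qed

lemma memL2_box_integrable:
  assumes "memL2 f" shows "integrable lborel (\<lambda>x. indicator (box a b) x * f x)"
proof (rule Bochner_Integration.integrable_bound)
  have [measurable]: "f \<in> borel_measurable borel" using assms by (simp add: memL2_def)
  show "(\<lambda>x. indicator (box a b) x * f x) \<in> borel_measurable lborel" by measurable
  show "integrable lborel (\<lambda>x. indicator (box a b) x + (f x)\<^sup>2)"
    using assms by (intro Bochner_Integration.integrable_add integrable_real_indicator)
      (use emeasure_lborel_box_finite in \<open>auto simp: memL2_def\<close>)
  have "\<bar>t\<bar> \<le> 1 + t\<^sup>2" for t :: real
  proof -
    have "0 \<le> (\<bar>t\<bar> - 1)\<^sup>2" by simp
    then have "2 * \<bar>t\<bar> \<le> 1 + t\<^sup>2" by (simp add: power2_diff)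
    then show ?thesis using abs_ge_zero[of t] by linarith
  qed
  then show "AE x in lborel. norm (indicator (box a b) x * f x) \<le> norm (indicator (box a b) x + (f x)\<^sup>2)"
    by (intro AE_I2) (auto simp: indicator_def)
qed

text \<open>The bumps lie between 0 and the indicator of the box and converge to it, so dominated
  convergence carries the hypothesis from test functions to boxes.\<close>

lemma memL2_test_zero_imp_AE_zero:
  assumes f: "memL2 f" and zero: "\<And>\<psi>. test_fn \<psi> \<Longrightarrow> (\<integral>x. f x * \<psi> x \<partial>lborel) = 0"
  shows "AE x in lborel. f x = 0"
proof (rule AE_zero_if_box_integrals_zero)
  show [measurable]: "f \<in> borel_measurable borel" using f by (simp add: memL2_def)
  show int: "integrable lborel (\<lambda>x. indicator (box a b) x * f x)" for a b
    by (rule memL2_box_integrable[OF f])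
  show "(\<integral>x. indicator (box a b) x * f x \<partial>lborel) = 0" for a b
  proof -
    have "(\<lambda>n. \<integral>x. bump (Suc n) a b x * f x \<partial>lborel) \<longlonglongrightarrow> (\<integral>x. indicator (box a b) x * f x \<partial>lborel)"
    proof (rule integral_dominated_convergence)
      show "integrable lborel (\<lambda>x. \<bar>indicator (box a b) x * f x\<bar>)"
        using int by (rule integrable_abs)
      show "AE x in lborel. (\<lambda>n. bump (Suc n) a b x * f x) \<longlonglongrightarrow> indicator (box a b) x * f x"
        by (intro AE_I2 tendsto_intros bump_tendsto)
      have [measurable]: "bump (Suc n) a b \<in> borel_measurable borel" for n
        by (intro Cc_measurable test_fn_Cc test_fn_bump) simp
      show "(\<lambda>x. bump (Suc n) a b x * f x) \<in> borel_measurable lborel" for n by measurable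
      show "AE x in lborel. norm (bump (Suc n) a b x * f x) \<le> \<bar>indicator (box a b) x * f x\<bar>" for n
      proof (intro AE_I2)
        fix x
        show "norm (bump (Suc n) a b x * f x) \<le> \<bar>indicator (box a b) x * f x\<bar>"
          using bump_nonzero_iff[of "Suc n" a b x] bump_bounds[of "Suc n" a b x]
          by (cases "x \<in> box a b") (auto simp: abs_mult mult_left_le_one_le)
      qed
    qed measurable
    moreover have "(\<integral>x. bump (Suc n) a b x * f x \<partial>lborel) = 0" for n
      using zero[OF test_fn_bump[of "Suc n" a b]] by (simp add: mult.commute)
    ultimately show ?thesis by (simp add: LIMSEQ_const_iff)
  qed
qed

lemma memL2_test_integrable:
  assumes f: "memL2 f" and \<psi>: "test_fn \<psi>"
  shows "integrable lborel (\<lambda>x. f x * \<psi> x)"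
proof (rule Bochner_Integration.integrable_bound)
  have [measurable]: "f \<in> borel_measurable borel" "\<psi> \<in> borel_measurable borel"
    using f Cc_measurable[OF test_fn_Cc[OF \<psi>]] by (auto simp: memL2_def)
  show "(\<lambda>x. f x * \<psi> x) \<in> borel_measurable lborel" by measurable
  show "integrable lborel (\<lambda>x. (f x)\<^sup>2 + (\<psi> x)\<^sup>2)"
    using f Cc_integrable[OF Cc_power2[OF test_fn_Cc[OF \<psi>]]] by (auto simp: memL2_def)
  have "\<bar>s * t\<bar> \<le> s\<^sup>2 + t\<^sup>2" for s t :: real
  proof -
    have "2 * \<bar>s * t\<bar> \<le> s\<^sup>2 + t\<^sup>2"
      using sum_squares_bound[of "\<bar>s\<bar>" "\<bar>t\<bar>"] by (simp add: abs_mult)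
    then show ?thesis using abs_ge_zero[of "s * t"] by linarith
  qed
  then show "AE x in lborel. norm (f x * \<psi> x) \<le> norm ((f x)\<^sup>2 + (\<psi> x)\<^sup>2)"
    by (intro AE_I2) auto
qed

lemma weak_deriv_unique:
  assumes "memL2 f" "weak_deriv is h f" "memL2 g" "weak_deriv is h g"
  shows "AE x in lborel. f x = g x"
proof -
  have "memL2 (\<lambda>x. f x - g x)"
  proof -
    have [measurable]: "f \<in> borel_measurable borel" "g \<in> borel_measurable borel"
      using assms by (auto simp: memL2_def)
    have "integrable lborel (\<lambda>x. (f x - g x)\<^sup>2)"
    proof (rule Bochner_Integration.integrable_bound)
      show "integrable lborel (\<lambda>x. 2 * (f x)\<^sup>2 + 2 * (g x)\<^sup>2)"
        using assms by (auto simp: memL2_def)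
      have "(s - t)\<^sup>2 \<le> 2 * s\<^sup>2 + 2 * t\<^sup>2" for s t :: real
        using zero_le_power2[of "s + t"] by (simp add: power2_eq_square algebra_simps)
      then show "AE x in lborel. norm ((f x - g x)\<^sup>2) \<le> norm (2 * (f x)\<^sup>2 + 2 * (g x)\<^sup>2)"
        by (intro AE_I2) auto
    qed measurable
    then show ?thesis by (simp add: memL2_def)
  qed
  moreover have "(\<integral>x. (f x - g x) * \<psi> x \<partial>lborel) = 0" if \<psi>: "test_fn \<psi>" for \<psi>
  proof -
    have "(-1) ^ length is * (\<integral>x. f x * \<psi> x \<partial>lborel) = (-1) ^ length is * (\<integral>x. g x * \<psi> x \<partial>lborel)"
      using assms(2,4) \<psi> unfolding weak_deriv_def by simp
    then have "(\<integral>x. f x * \<psi> x \<partial>lborel) = (\<integral>x. g x * \<psi> x \<partial>lborel)" by simp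
    then show ?thesis
      using memL2_test_integrable[OF _ \<psi>] assms by (simp add: left_diff_distrib)
  qed
  ultimately have "AE x in lborel. f x - g x = 0"
    by (rule memL2_test_zero_imp_AE_zero)
  then show ?thesis by simp
qed

text \<open>The representative behind \<open>wd\<close> is an arbitrary choice; uniqueness almost
  everywhere lets any explicit weak derivative stand in for it inside a norm.\<close>

lemma L2norm_wd:
  assumes "memL2 g" "weak_deriv is f g"
  shows "L2norm (wd is f) = L2norm g"
proof -
  have w: "memL2 (wd is f) \<and> weak_deriv is f (wd is f)"
    unfolding wd_def by (rule someI[of "\<lambda>g. memL2 g \<and> weak_deriv is f g"]) (use assms in simp)
  then have "AE x in lborel. (wd is f x)\<^sup>2 = (g x)\<^sup>2"
    using weak_deriv_unique[of "wd is f" "is" f g] assms by auto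
  moreover have "(\<lambda>x. (wd is f x)\<^sup>2) \<in> borel_measurable lborel" "(\<lambda>x. (g x)\<^sup>2) \<in> borel_measurable lborel"
    using w assms by (auto simp: memL2_def)
  ultimately show ?thesis
    unfolding L2norm_def by (subst integral_cong_AE[of _ lborel "\<lambda>x. (g x)\<^sup>2"]) auto
qed

lemma H3norm_hartley:
  assumes "Cc g"
  shows "H3norm (hartley g) = sqrt (\<Sum>is\<in>{is::3 list. length is \<le> 3}. (2 * pi) ^ 3 * (\<integral>\<xi>. (mdiffs is g \<xi>)\<^sup>2 \<partial>lborel))"
proof -
  have "(L2norm (wd is (hartley g)))\<^sup>2 = (2 * pi) ^ 3 * (\<integral>\<xi>. (mdiffs is g \<xi>)\<^sup>2 \<partial>lborel)" for "is"
    unfolding L2norm_wd[OF memL2_hartley[OF Cc_mdiffs[OF assms]] weak_deriv_hartley[OF assms]]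
    by (rule L2norm_hartley[OF Cc_mdiffs[OF assms]])
  then show ?thesis unfolding H3norm_def by simp
qed

section \<open>Modes with exponential growth\<close>

lemma exp_difference_quotient_bound:
  fixes l s t :: real
  assumes "\<bar>l\<bar> \<le> B" "\<bar>s\<bar> \<le> T" "\<bar>t\<bar> \<le> T"
  shows "\<bar>(exp (l * s) - exp (l * t)) / (s - t)\<bar> \<le> B * exp (B * T)"
proof -
  have B: "0 \<le> B" and T: "0 \<le> T" using assms by linarith+
  have "norm (exp (l * s) - exp (l * t)) \<le> B * exp (B * T) * norm (s - t)"
  proof (rule field_differentiable_bound[of "{-T..T}" "\<lambda>s. exp (l * s)" "\<lambda>s. l * exp (l * s)"])
    fix z assume z: "z \<in> {-T..T}"
    show "((\<lambda>s. exp (l * s)) has_real_derivative l * exp (l * z)) (at z within {-T..T})"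
      by (auto intro!: derivative_eq_intros)
    have "l * z \<le> \<bar>l\<bar> * \<bar>z\<bar>" by (metis abs_ge_self abs_mult)
    also have "\<dots> \<le> B * T" using z assms B by (intro mult_mono) auto
    finally show "norm (l * exp (l * z)) \<le> B * exp (B * T)"
      using assms B by (simp add: abs_mult mult_mono)
  qed (use assms in auto)
  \<comment> \<open>For \<open>s = t\<close> the quotient is a division by 0, hence 0, and the bound
    still holds.\<close>
  then show ?thesis
    using B by (cases "s = t") (simp_all add: abs_divide divide_le_eq)
qed

text \<open>The bounded exponent gives difference quotients a bound uniform in \<xi> for times in a
  bounded interval, so a constant multiple of |G| dominates.\<close>

lemma DERIV_integral_exp:
  fixes G l :: "'a::euclidean_space \<Rightarrow> real"
  assumes G: "integrable lborel G" and [measurable]: "l \<in> borel_measurable borel"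
    and B: "\<And>\<xi>. \<bar>l \<xi>\<bar> \<le> B"
  shows "((\<lambda>s. \<integral>\<xi>. G \<xi> * exp (l \<xi> * s) \<partial>lborel) has_real_derivative
           (\<integral>\<xi>. G \<xi> * (l \<xi> * exp (l \<xi> * t)) \<partial>lborel)) (at t)"
proof -
  have [measurable]: "G \<in> borel_measurable borel" using G by simp
  have int: "integrable lborel (\<lambda>\<xi>. G \<xi> * exp (l \<xi> * s))" for s
  proof (rule Bochner_Integration.integrable_bound)
    show "integrable lborel (\<lambda>\<xi>. exp (B * \<bar>s\<bar>) * G \<xi>)" using G by simp
    show "AE \<xi> in lborel. norm (G \<xi> * exp (l \<xi> * s)) \<le> norm (exp (B * \<bar>s\<bar>) * G \<xi>)"
    proof (intro AE_I2)
      fix \<xi>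
      have "l \<xi> * s \<le> \<bar>l \<xi>\<bar> * \<bar>s\<bar>" by (metis abs_ge_self abs_mult)
      also have "\<dots> \<le> B * \<bar>s\<bar>" using B by (intro mult_right_mono) auto
      finally show "norm (G \<xi> * exp (l \<xi> * s)) \<le> norm (exp (B * \<bar>s\<bar>) * G \<xi>)"
        by (simp add: abs_mult mult.commute mult_left_mono)
    qed
  qed measurable
  show ?thesis
    unfolding DERIV_def tendsto_at_iff_sequentially
  proof (intro allI impI)
    fix X :: "nat \<Rightarrow> real" assume "\<forall>i. X i \<in> UNIV - {0}" and X: "X \<longlonglongrightarrow> 0"
    then have X0: "X i \<noteq> 0" for i by auto
    \<comment> \<open>A convergent sequence is bounded; \<open>K\<close> keeps all times
      \<open>t + X i\<close> inside one interval [-T, T], on which a single dominating function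
      works.\<close>
    obtain K where K: "\<And>i. \<bar>X i\<bar> \<le> K"
      using X[THEN convergentI, THEN convergent_imp_Bseq] by (auto simp: Bseq_def)
    define T where "T = \<bar>t\<bar> + K"
    have T: "\<bar>t + X i\<bar> \<le> T" "\<bar>t\<bar> \<le> T" for i
      using K[of i] by (auto simp: T_def)
    have "(\<lambda>i. \<integral>\<xi>. G \<xi> * ((exp (l \<xi> * (t + X i)) - exp (l \<xi> * t)) / ((t + X i) - t)) \<partial>lborel)
        \<longlonglongrightarrow> (\<integral>\<xi>. G \<xi> * (l \<xi> * exp (l \<xi> * t)) \<partial>lborel)"
    proof (rule integral_dominated_convergence)
      show "integrable lborel (\<lambda>\<xi>. B * exp (B * T) * \<bar>G \<xi>\<bar>)" using G by simp
      show "AE \<xi> in lborel. (\<lambda>i. G \<xi> * ((exp (l \<xi> * (t + X i)) - exp (l \<xi> * t)) / ((t + X i) - t)))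
          \<longlonglongrightarrow> G \<xi> * (l \<xi> * exp (l \<xi> * t))"
      proof (intro AE_I2 tendsto_mult[OF tendsto_const])
        fix \<xi>
        have "((\<lambda>s. exp (l \<xi> * s)) has_real_derivative l \<xi> * exp (l \<xi> * t)) (at t)"
          by (auto intro!: derivative_eq_intros)
        then have "((\<lambda>h. (exp (l \<xi> * (t + h)) - exp (l \<xi> * t)) / h) \<longlongrightarrow> l \<xi> * exp (l \<xi> * t)) (at 0)"
          by (simp add: DERIV_def)
        moreover have "filterlim X (at 0) sequentially"
          using X X0 by (simp add: filterlim_at)
        ultimately have "(\<lambda>i. (exp (l \<xi> * (t + X i)) - exp (l \<xi> * t)) / X i) \<longlonglongrightarrow> l \<xi> * exp (l \<xi> * t)"
          by (rule filterlim_compose)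
        then show "(\<lambda>i. (exp (l \<xi> * (t + X i)) - exp (l \<xi> * t)) / ((t + X i) - t))
          \<longlonglongrightarrow> l \<xi> * exp (l \<xi> * t)"
          by simp
      qed
      show "AE \<xi> in lborel. norm (G \<xi> * ((exp (l \<xi> * (t + X i)) - exp (l \<xi> * t)) / ((t + X i) - t)))
          \<le> B * exp (B * T) * \<bar>G \<xi>\<bar>" for i
        using mult_left_mono[OF exp_difference_quotient_bound[OF B T] abs_ge_zero]
        unfolding real_norm_def abs_mult mult.commute[of "B * exp (B * T)"] by (intro AE_I2)
    qed measurable
    moreover have "(\<integral>\<xi>. G \<xi> * ((exp (l \<xi> * (t + X i)) - exp (l \<xi> * t)) / ((t + X i) - t)) \<partial>lborel)
        = ((\<integral>\<xi>. G \<xi> * exp (l \<xi> * (t + X i)) \<partial>lborel) - (\<integral>\<xi>. G \<xi> * exp (l \<xi> * t) \<partial>lborel)) / X i" for i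
      using int by (simp add: right_diff_distrib diff_divide_distrib)
    ultimately show "((\<lambda>h. ((\<integral>\<xi>. G \<xi> * exp (l \<xi> * (t + h)) \<partial>lborel) - (\<integral>\<xi>. G \<xi> * exp (l \<xi> * t) \<partial>lborel)) / h) \<circ> X) \<longlonglongrightarrow> (\<integral>\<xi>. G \<xi> * (l \<xi> * exp (l \<xi> * t)) \<partial>lborel)"
      by (simp only: o_def)
  qed
qed


section \<open>Norms and time continuity of exponentially evolving profiles\<close>

lemma Cc_exp_mult:
  assumes "Cc g" "continuous_on UNIV l"
  shows "Cc (\<lambda>\<xi>. g \<xi> * exp (l \<xi> * t))"
  unfolding mult.commute[of "g _"] using assms by (intro Cc_mult continuous_intros)

text \<open>By Plancherel both sides become integrals over frequencies, and there the bounds hold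
  pointwise because t is nonnegative.\<close>

lemma L2norm_hartley_exp_bounds:
  assumes g: "Cc g" and l: "continuous_on UNIV l"
    and m: "\<And>\<xi>. m \<le> l \<xi>" and M: "\<And>\<xi>. l \<xi> \<le> M" and t: "t \<ge> 0"
  shows "exp (m * t) * L2norm (hartley g) \<le> L2norm (hartley (\<lambda>\<xi>. g \<xi> * exp (l \<xi> * t)))"
    and "L2norm (hartley (\<lambda>\<xi>. g \<xi> * exp (l \<xi> * t))) \<le> exp (M * t) * L2norm (hartley g)"
proof -
  have nonneg: "L2norm f \<ge> 0" for f by (simp add: L2norm_def)
  note C = Cc_exp_mult[OF g l, of t]
  have i: "integrable lborel (\<lambda>\<xi>. (g \<xi>)\<^sup>2)" "integrable lborel (\<lambda>\<xi>. (g \<xi> * exp (l \<xi> * t))\<^sup>2)"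
    using Cc_integrable[OF Cc_power2] g C by auto
  have "(exp (m * t))\<^sup>2 * (\<integral>\<xi>. (g \<xi>)\<^sup>2 \<partial>lborel) \<le> (\<integral>\<xi>. (g \<xi> * exp (l \<xi> * t))\<^sup>2 \<partial>lborel)"
    unfolding integral_mult_right_zero[symmetric] using i m M t
    by (intro integral_mono) (auto simp: power_mult_distrib mult.commute[of "(g _)\<^sup>2"] mult_right_mono[OF m t] intro!: mult_right_mono power_mono)
  then have "(exp (m * t) * L2norm (hartley g))\<^sup>2 \<le> (L2norm (hartley (\<lambda>\<xi>. g \<xi> * exp (l \<xi> * t))))\<^sup>2"
    unfolding power_mult_distrib L2norm_hartley[OF g] L2norm_hartley[OF C]
    by (simp add: power_mult_distrib)
  then show "exp (m * t) * L2norm (hartley g) \<le> L2norm (hartley (\<lambda>\<xi>. g \<xi> * exp (l \<xi> * t)))"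
    by (rule power2_le_imp_le) (rule nonneg)
  have "(\<integral>\<xi>. (g \<xi> * exp (l \<xi> * t))\<^sup>2 \<partial>lborel) \<le> (exp (M * t))\<^sup>2 * (\<integral>\<xi>. (g \<xi>)\<^sup>2 \<partial>lborel)"
    unfolding integral_mult_right_zero[symmetric] using i m M t
    by (intro integral_mono) (auto simp: power_mult_distrib mult.commute[of "(g _)\<^sup>2"] mult_right_mono[OF M t] intro!: mult_right_mono power_mono)
  then have "(L2norm (hartley (\<lambda>\<xi>. g \<xi> * exp (l \<xi> * t))))\<^sup>2 \<le> (exp (M * t) * L2norm (hartley g))\<^sup>2"
    unfolding power_mult_distrib L2norm_hartley[OF g] L2norm_hartley[OF C]
    by (simp add: power_mult_distrib)
  then show "L2norm (hartley (\<lambda>\<xi>. g \<xi> * exp (l \<xi> * t))) \<le> exp (M * t) * L2norm (hartley g)"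
    by (rule power2_le_imp_le) (simp add: nonneg)
qed

text \<open>A vanishing norm makes the zero set of \<open>g\<close> of full measure; by continuity
  that set is closed, hence contains every point.\<close>

lemma L2norm_hartley_pos:
  assumes g: "Cc g" and nz: "g \<xi>0 \<noteq> 0"
  shows "L2norm (hartley g) > 0"
proof -
  have i: "integrable lborel (\<lambda>\<xi>. (g \<xi>)\<^sup>2)" using Cc_integrable[OF Cc_power2[OF g]] .
  have "(\<integral>\<xi>. (g \<xi>)\<^sup>2 \<partial>lborel) \<noteq> 0"
  proof
    assume "(\<integral>\<xi>. (g \<xi>)\<^sup>2 \<partial>lborel) = 0"
    then have "AE \<xi> in lborel. g \<xi> = 0"
      by (subst (asm) integral_nonneg_eq_0_iff_AE[OF i]) auto
    then have "AE \<xi> in lebesgue. \<xi> \<in> g -` {0}"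
      by (intro AE_completion) simp
    moreover have "closed (g -` {0})"
      using Cc_continuous[OF g] by (intro closed_vimage) auto
    ultimately have "\<xi>0 \<in> g -` {0}" by (intro mem_closed_if_AE_lebesgue)
    then show False using nz by simp
  qed
  moreover have "(\<integral>\<xi>. (g \<xi>)\<^sup>2 \<partial>lborel) \<ge> 0" by simp
  ultimately have "(\<integral>\<xi>. (g \<xi>)\<^sup>2 \<partial>lborel) > 0"
    by (metis less_le)
  then have "(L2norm (hartley g))\<^sup>2 > 0"
    unfolding L2norm_hartley[OF g] by (intro mult_pos_pos zero_less_power) auto
  moreover have "L2norm (hartley g) \<ge> 0" by (simp add: L2norm_def)
  ultimately show ?thesis by (simp add: zero_less_power2 less_le)
qed

text \<open>An even factor is not affected by the reflections inside \<open>mdiff\<close>, so the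
  time factor passes through all derivatives.\<close>

lemma mdiffs_mult_even:
  assumes "\<And>\<xi>. E (- \<xi>) = E \<xi>"
  shows "mdiffs is (\<lambda>\<xi>. g \<xi> * E \<xi>) = (\<lambda>\<xi>. mdiffs is g \<xi> * E \<xi>)"
proof (induction "is" arbitrary: g)
  case (Cons i "is")
  have "mdiff i (\<lambda>\<xi>. g \<xi> * E \<xi>) = (\<lambda>\<xi>. mdiff i g \<xi> * E \<xi>)"
    by (simp add: fun_eq_iff mdiff_def assms)
  then show ?case by (simp add: Cons.IH)
qed simp

lemma hartley_diff:
  assumes "integrable lborel f" "integrable lborel g"
  shows "hartley (\<lambda>\<xi>. f \<xi> - g \<xi>) x = hartley f x - hartley g x"
  using hartley_integrand_integrable[of f x] hartley_integrand_integrable[of g x] assms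
  by (simp add: hartley_def left_diff_distrib)

text \<open>The difference of two time slices is again a Hartley transform, so its
  \<open>H3norm\<close> is a finite sum of weighted integrals of the squared difference of the
  exponentials. Each of these tends to 0.\<close>

lemma C0H3_hartley_exp:
  assumes g: "Cc g" and l: "continuous_on UNIV l" and even: "\<And>\<xi>. l (- \<xi>) = l \<xi>"
    and B: "\<And>\<xi>. \<bar>l \<xi>\<bar> \<le> B"
  shows "C0H3 (\<lambda>t. hartley (\<lambda>\<xi>. g \<xi> * exp (l \<xi> * t)))"
  unfolding C0H3_def
proof (intro conjI allI impI)
  note C = Cc_exp_mult[OF g l]
  have [measurable]: "l \<in> borel_measurable borel"
    using l by (rule borel_measurable_continuous_onI)
  show "H3 (hartley (\<lambda>\<xi>. g \<xi> * exp (l \<xi> * t)))" for t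
    by (rule H3_hartley[OF C])
  fix t :: real
  have Cd: "Cc (\<lambda>\<xi>. g \<xi> * (exp (l \<xi> * s) - exp (l \<xi> * t)))" for s
    using Cc_diff[OF C[of s] C[of t]] by (simp add: right_diff_distrib)
  have "(\<lambda>x. hartley (\<lambda>\<xi>. g \<xi> * exp (l \<xi> * s)) x - hartley (\<lambda>\<xi>. g \<xi> * exp (l \<xi> * t)) x)
      = hartley (\<lambda>\<xi>. g \<xi> * (exp (l \<xi> * s) - exp (l \<xi> * t)))" for s
    using hartley_diff[OF Cc_integrable[OF C[of s]] Cc_integrable[OF C[of t]]]
    by (simp add: right_diff_distrib fun_eq_iff)
  moreover have "mdiffs is (\<lambda>\<xi>. g \<xi> * (exp (l \<xi> * s) - exp (l \<xi> * t)))
      = (\<lambda>\<xi>. mdiffs is g \<xi> * (exp (l \<xi> * s) - exp (l \<xi> * t)))" for s "is"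
    by (rule mdiffs_mult_even) (simp add: even)
  ultimately have H: "H3norm (\<lambda>x. hartley (\<lambda>\<xi>. g \<xi> * exp (l \<xi> * s)) x - hartley (\<lambda>\<xi>. g \<xi> * exp (l \<xi> * t)) x)
      = sqrt (\<Sum>is\<in>{is::3 list. length is \<le> 3}. (2 * pi) ^ 3 *
          (\<integral>\<xi>. (mdiffs is g \<xi> * (exp (l \<xi> * s) - exp (l \<xi> * t)))\<^sup>2 \<partial>lborel))" for s
    using H3norm_hartley[OF Cd[of s]] by simp
  have lim: "((\<lambda>s. \<integral>\<xi>. (G \<xi> * (exp (l \<xi> * s) - exp (l \<xi> * t)))\<^sup>2 \<partial>lborel) \<longlongrightarrow> 0) (at t within {0..})"
    if G: "Cc G" for G
  proof -
    have G2: "Cc (\<lambda>\<xi>. (G \<xi>)\<^sup>2)" by (rule Cc_power2[OF G])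
    have Gt: "Cc (\<lambda>\<xi>. (G \<xi>)\<^sup>2 * exp (l \<xi> * t))" by (rule Cc_exp_mult[OF G2 l])
    \<comment> \<open>Expanding the square leaves exponential integrals in \<open>s\<close> and a
      constant; \<open>DERIV_integral_exp\<close> makes them continuous, and \<open>F t\<close> is
      0.\<close>
    define F where "F s = (\<integral>\<xi>. (G \<xi>)\<^sup>2 * exp (2 * l \<xi> * s) \<partial>lborel)
      - 2 * (\<integral>\<xi>. ((G \<xi>)\<^sup>2 * exp (l \<xi> * t)) * exp (l \<xi> * s) \<partial>lborel)
      + (\<integral>\<xi>. (G \<xi>)\<^sup>2 * exp (2 * l \<xi> * t) \<partial>lborel)" for s
    have F: "(\<integral>\<xi>. (G \<xi> * (exp (l \<xi> * s) - exp (l \<xi> * t)))\<^sup>2 \<partial>lborel) = F s" for s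
    proof -
      have e: "(G \<xi> * (exp (l \<xi> * s) - exp (l \<xi> * t)))\<^sup>2 = (G \<xi>)\<^sup>2 * exp (2 * l \<xi> * s)
          - 2 * (((G \<xi>)\<^sup>2 * exp (l \<xi> * t)) * exp (l \<xi> * s)) + (G \<xi>)\<^sup>2 * exp (2 * l \<xi> * t)" for \<xi>
      proof -
        have "exp (2 * l \<xi> * r) = (exp (l \<xi> * r))\<^sup>2" for r
          by (simp add: exp_double mult.assoc)
        then show ?thesis by (simp only:) (simp add: power2_eq_square algebra_simps)
      qed
      have i: "integrable lborel (\<lambda>\<xi>. (G \<xi>)\<^sup>2 * exp (2 * l \<xi> * r))" for r
        using l by (intro Cc_integrable Cc_exp_mult[OF G2] continuous_intros)
      have j: "integrable lborel (\<lambda>\<xi>. ((G \<xi>)\<^sup>2 * exp (l \<xi> * t)) * exp (l \<xi> * s))"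
        by (intro Cc_integrable Cc_exp_mult[OF Gt l])
      show ?thesis
        unfolding e F_def using i j by simp
    qed
    have "isCont (\<lambda>s. \<integral>\<xi>. (G \<xi>)\<^sup>2 * exp (2 * l \<xi> * s) \<partial>lborel) t"
      using B by (intro DERIV_isCont[OF DERIV_integral_exp[where B = "2 * B"]] Cc_integrable[OF G2])
        (auto simp: abs_mult)
    moreover have "isCont (\<lambda>s. \<integral>\<xi>. ((G \<xi>)\<^sup>2 * exp (l \<xi> * t)) * exp (l \<xi> * s) \<partial>lborel) t"
      using B by (intro DERIV_isCont[OF DERIV_integral_exp[where B = B]] Cc_integrable[OF Gt]) auto
    ultimately have "isCont F t"
      unfolding F_def by (intro continuous_intros)
    then have "(F \<longlongrightarrow> F t) (at t within {0..})"
      using continuous_at_imp_continuous_at_within[of t F] by (simp add: continuous_within)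
    moreover have "F t = 0" using F[of t] by simp
    ultimately show ?thesis by (simp add: F)
  qed
  have "((\<lambda>s. sqrt (\<Sum>is\<in>{is::3 list. length is \<le> 3}. (2 * pi) ^ 3 *
          (\<integral>\<xi>. (mdiffs is g \<xi> * (exp (l \<xi> * s) - exp (l \<xi> * t)))\<^sup>2 \<partial>lborel)))
      \<longlongrightarrow> sqrt (\<Sum>is\<in>{is::3 list. length is \<le> 3}. (2 * pi) ^ 3 * 0)) (at t within {0..})"
    by (intro tendsto_real_sqrt tendsto_sum tendsto_mult tendsto_const lim Cc_mdiffs g)
  then show "((\<lambda>s. H3norm (\<lambda>x. hartley (\<lambda>\<xi>. g \<xi> * exp (l \<xi> * s)) x - hartley (\<lambda>\<xi>. g \<xi> * exp (l \<xi> * t)) x)) \<longlongrightarrow> 0)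
      (at t within {0..})"
    unfolding H by simp
qed

section \<open>Solutions with radial spectrum\<close>

lemma power2_norm_vec: "(norm (x :: real^'n))\<^sup>2 = (\<Sum>k\<in>UNIV. (x $ k)\<^sup>2)"
  unfolding power2_norm_eq_inner inner_vec_def by (simp add: power2_eq_square)

lemma Cc_mult_hartley_integrable:
  assumes "Cc F" "test_fn \<psi>" shows "integrable lborel (\<lambda>\<xi>. F \<xi> * hartley \<psi> \<xi>)"
proof (rule Bochner_Integration.integrable_bound)
  have \<psi>: "integrable lborel \<psi>" using Cc_integrable[OF test_fn_Cc[OF assms(2)]] .
  define K where "K = 2 * (\<integral>x. \<bar>\<psi> x\<bar> \<partial>lborel)"
  have [measurable]: "F \<in> borel_measurable borel" "\<psi> \<in> borel_measurable borel"
    using Cc_measurable[OF assms(1)] Cc_measurable[OF test_fn_Cc[OF assms(2)]] by simp_all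
  show "(\<lambda>\<xi>. F \<xi> * hartley \<psi> \<xi>) \<in> borel_measurable lborel" by measurable
  show "integrable lborel (\<lambda>\<xi>. K * F \<xi>)" using Cc_integrable[OF assms(1)] by simp
  have "\<bar>hartley \<psi> \<xi>\<bar> \<le> \<bar>K\<bar>" for \<xi>
    using hartley_bound[OF \<psi>, of \<xi>] unfolding K_def by linarith
  then show "AE \<xi> in lborel. norm (F \<xi> * hartley \<psi> \<xi>) \<le> norm (K * F \<xi>)"
    unfolding real_norm_def abs_mult mult.commute[of "\<bar>K\<bar>"] by (intro AE_I2 mult_left_mono) auto
qed

text \<open>The radial profile carries a factor \<open>s = |\<xi>|\<^sup>2\<close> in the density, so that the velocity, which the
  continuity equation gives as a multiple of \<open>\<xi> / |\<xi>|\<^sup>2\<close>, is continuous at \<open>\<xi> = 0\<close>.\<close>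

locale radial_mode =
  fixes \<rho>b \<mu> \<mu>' a \<gamma> B S :: real and L H :: "real \<Rightarrow> real"
  assumes \<rho>b: "\<rho>b > 0"
    and L_cont: "continuous_on {0..} L" and H_cont: "continuous_on {0..} H"
    and L_bound: "\<And>s. \<bar>L s\<bar> \<le> B" and H_supp: "\<And>s. s > S \<Longrightarrow> H s = 0"
    and dispersion: "\<And>s. s \<ge> 0 \<Longrightarrow> H s \<noteq> 0 \<Longrightarrow>
      (L s)\<^sup>2 + (2 * \<mu> + \<mu>') / \<rho>b * s * L s + s * (a + \<gamma> * \<rho>b / (1 + s)) = 0"
begin

definition l :: "R3 \<Rightarrow> real" where "l \<xi> = L ((norm \<xi>)\<^sup>2)"
definition h :: "R3 \<Rightarrow> real" where "h \<xi> = H ((norm \<xi>)\<^sup>2)"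

definition \<rho>_hat :: "R3 \<Rightarrow> real" where "\<rho>_hat \<xi> = (norm \<xi>)\<^sup>2 * h \<xi>"
text \<open>This is the gradient of the Hartley transform of l h / \<rho>b, since l and h are even.
  The velocity is thus curl-free, and its divergence balances the time derivative of the
  density.\<close>

definition u_hat :: "3 \<Rightarrow> R3 \<Rightarrow> real" where "u_hat j \<xi> = - (\<xi> $ j / \<rho>b * l \<xi>) * h \<xi>"
definition \<phi>_hat :: "R3 \<Rightarrow> real" where "\<phi>_hat \<xi> = (norm \<xi>)\<^sup>2 / (1 + (norm \<xi>)\<^sup>2) * h \<xi>"

definition evolve :: "(R3 \<Rightarrow> real) \<Rightarrow> real \<Rightarrow> R3 \<Rightarrow> real" where
  "evolve g t \<xi> = g \<xi> * exp (l \<xi> * t)"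

definition \<rho> :: "real \<Rightarrow> R3 \<Rightarrow> real" where "\<rho> t = hartley (evolve \<rho>_hat t)"
definition u :: "real \<Rightarrow> R3 \<Rightarrow> R3" where "u t x = (\<chi> j. hartley (evolve (u_hat j) t) x)"

lemma l_even: "l (- \<xi>) = l \<xi>" and h_even: "h (- \<xi>) = h \<xi>"
  by (simp_all add: l_def h_def)

lemma l_bound: "\<bar>l \<xi>\<bar> \<le> B"
  by (simp add: l_def L_bound)

lemma l_cont: "continuous_on UNIV l"
  unfolding l_def by (intro continuous_on_compose2[OF L_cont] continuous_intros) auto

lemma h_Cc: "Cc h"
proof -
  have "continuous_on UNIV h"
    unfolding h_def by (intro continuous_on_compose2[OF H_cont] continuous_intros) auto
  \<comment> \<open>Taking the radius at least 1 gives |x| \<le> \<open>|x|\<^sup>2\<close>, which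
    avoids a square root of \<open>S\<close>, whose sign is not fixed.\<close>
  moreover have "h x = 0" if "norm x > max 1 S" for x
  proof -
    have "norm x * 1 \<le> norm x * norm x" using that by (intro mult_left_mono) auto
    then have "S < (norm x)\<^sup>2" using that by (simp add: power2_eq_square)
    then show ?thesis by (simp add: h_def H_supp)
  qed
  ultimately show ?thesis unfolding Cc_def by blast
qed

lemma one_plus_norm_neq_0: "1 + (norm (\<xi> :: R3))\<^sup>2 \<noteq> 0"
  using zero_le_power2[of "norm \<xi>"] by linarith

lemma hat_Cc: "Cc \<rho>_hat" "Cc (u_hat j)" "Cc \<phi>_hat"
  unfolding \<rho>_hat_def[abs_def] u_hat_def[abs_def] \<phi>_hat_def[abs_def]
  by (intro Cc_mult h_Cc continuous_intros l_cont one_plus_norm_neq_0 ballI; simp add: \<rho>b less_imp_neq[symmetric] one_plus_norm_neq_0)+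

lemma evolve_Cc: "Cc g \<Longrightarrow> Cc (evolve g t)"
  unfolding evolve_def[abs_def] by (rule Cc_exp_mult[OF _ l_cont])

lemma C0H3_evolve: "Cc g \<Longrightarrow> C0H3 (\<lambda>t. hartley (evolve g t))"
  unfolding evolve_def[abs_def]
  by (rule C0H3_hartley_exp[OF _ l_cont l_even l_bound])

text \<open>On the frequency side the pairing depends on time only through exp(l t), so
  differentiation multiplies the integrand by l.\<close>

lemma DERIV_evolve:
  assumes g: "Cc g" and \<psi>: "test_fn \<psi>"
  shows "((\<lambda>s. \<integral>x. hartley (evolve g s) x * \<psi> x \<partial>lborel) has_real_derivative
    (\<integral>\<xi>. l \<xi> * evolve g t \<xi> * hartley \<psi> \<xi> \<partial>lborel)) (at t within {0..})"
proof -
  have e: "(\<integral>x. hartley (evolve g s) x * \<psi> x \<partial>lborel) = (\<integral>\<xi>. (g \<xi> * hartley \<psi> \<xi>) * exp (l \<xi> * s) \<partial>lborel)" for s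
    unfolding integral_hartley_test[OF evolve_Cc[OF g] \<psi>]
    by (intro Bochner_Integration.integral_cong refl) (simp add: evolve_def)
  have d: "(\<integral>\<xi>. l \<xi> * evolve g t \<xi> * hartley \<psi> \<xi> \<partial>lborel) = (\<integral>\<xi>. (g \<xi> * hartley \<psi> \<xi>) * (l \<xi> * exp (l \<xi> * t)) \<partial>lborel)"
    by (intro Bochner_Integration.integral_cong refl) (simp add: evolve_def)
  show ?thesis
    unfolding e d
    by (rule has_field_derivative_at_within, rule DERIV_integral_exp[OF _ _ l_bound])
       (intro Cc_mult_hartley_integrable g \<psi>, rule borel_measurable_continuous_onI, rule l_cont)
qed

lemma yukawa_pot_\<rho>: "yukawa_pot (\<rho> t) (hartley (evolve \<phi>_hat t))"
  unfolding yukawa_pot_def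
proof (intro conjI allI impI)
  note C = evolve_Cc[OF hat_Cc(3), of t]
  show "memL2 (hartley (evolve \<phi>_hat t))" by (rule memL2_hartley[OF C])
  fix \<psi> assume \<psi>: "test_fn \<psi>"
  note i = memL2_test_integrable[OF memL2_hartley[OF C]]
  \<comment> \<open>Two applications of \<open>mdiff k\<close> undo each other's reflection and
    leave the symbol \<open>- (\<xi> $ k)\<^sup>2\<close>; summed over k this makes 1 - \<Delta>
    multiplication by 1 + \<open>|\<xi>|\<^sup>2\<close>.\<close>
  have k: "(\<integral>x. hartley (evolve \<phi>_hat t) x * pdl [k,k] \<psi> x \<partial>lborel)
      = - (\<integral>\<xi>. (\<xi> $ k)\<^sup>2 * evolve \<phi>_hat t \<xi> * hartley \<psi> \<xi> \<partial>lborel)" for k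
    unfolding integral_hartley_pdl[OF C \<psi>] integral_hartley_test[OF Cc_mdiffs[OF C] \<psi>]
    by (simp add: mdiff_def[abs_def] power2_eq_square mult_ac)
  have j: "integrable lborel (\<lambda>\<xi>. (\<xi> $ k)\<^sup>2 * evolve \<phi>_hat t \<xi> * hartley \<psi> \<xi>)" for k
    by (intro Cc_mult_hartley_integrable[OF _ \<psi>] Cc_mult[OF _ C] continuous_intros)
  have "(\<integral>x. hartley (evolve \<phi>_hat t) x * (\<psi> x - (\<Sum>k\<in>UNIV. pdl [k,k] \<psi> x)) \<partial>lborel)
      = (\<integral>x. hartley (evolve \<phi>_hat t) x * \<psi> x \<partial>lborel) - (\<Sum>k\<in>UNIV. \<integral>x. hartley (evolve \<phi>_hat t) x * pdl [k,k] \<psi> x \<partial>lborel)"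
    using i[OF \<psi>] i[OF test_fn_pdl[OF \<psi>]]
    by (simp add: right_diff_distrib sum_distrib_left Bochner_Integration.integral_sum Bochner_Integration.integrable_sum del: pdl.simps)
  also have "\<dots> = (\<integral>\<xi>. evolve \<phi>_hat t \<xi> * hartley \<psi> \<xi> \<partial>lborel) + (\<integral>\<xi>. (\<Sum>k\<in>UNIV. (\<xi> $ k)\<^sup>2 * evolve \<phi>_hat t \<xi> * hartley \<psi> \<xi>) \<partial>lborel)"
    unfolding k integral_hartley_test[OF C \<psi>] using j by (simp add: Bochner_Integration.integral_sum sum_negf)
  also have "\<dots> = (\<integral>\<xi>. evolve \<phi>_hat t \<xi> * hartley \<psi> \<xi> + (\<Sum>k\<in>UNIV. (\<xi> $ k)\<^sup>2 * evolve \<phi>_hat t \<xi> * hartley \<psi> \<xi>) \<partial>lborel)"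
    using j Cc_mult_hartley_integrable[OF C \<psi>] by (intro Bochner_Integration.integral_add[symmetric]) auto
  also have "(\<lambda>\<xi>. evolve \<phi>_hat t \<xi> * hartley \<psi> \<xi> + (\<Sum>k\<in>UNIV. (\<xi> $ k)\<^sup>2 * evolve \<phi>_hat t \<xi> * hartley \<psi> \<xi>))
      = (\<lambda>\<xi>. evolve \<rho>_hat t \<xi> * hartley \<psi> \<xi>)"
  proof
    fix \<xi>
    have "\<rho>_hat \<xi> = \<phi>_hat \<xi> * (1 + (norm \<xi>)\<^sup>2)"
      using one_plus_norm_neq_0[of \<xi>] by (simp add: \<phi>_hat_def \<rho>_hat_def)
    then have eq: "evolve \<rho>_hat t \<xi> = evolve \<phi>_hat t \<xi> * (1 + (norm \<xi>)\<^sup>2)"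
      by (simp only: evolve_def mult_ac)
    show "evolve \<phi>_hat t \<xi> * hartley \<psi> \<xi> + (\<Sum>k\<in>UNIV. (\<xi> $ k)\<^sup>2 * evolve \<phi>_hat t \<xi> * hartley \<psi> \<xi>)
      = evolve \<rho>_hat t \<xi> * hartley \<psi> \<xi>"
      unfolding eq sum_distrib_right[symmetric] power2_norm_vec[symmetric] by (simp add: algebra_simps)
  qed
  also have "(\<integral>\<xi>. evolve \<rho>_hat t \<xi> * hartley \<psi> \<xi> \<partial>lborel) = (\<integral>x. \<rho> t x * \<psi> x \<partial>lborel)"
    unfolding \<rho>_def integral_hartley_test[OF evolve_Cc[OF hat_Cc(1)] \<psi>] ..
  finally show "(\<integral>x. hartley (evolve \<phi>_hat t) x * (\<psi> x - (\<Sum>k\<in>UNIV. pdl [k,k] \<psi> x)) \<partial>lborel) = (\<integral>x. \<rho> t x * \<psi> x \<partial>lborel)" .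
qed

lemma continuity_equation:
  assumes \<psi>: "test_fn \<psi>"
  shows "((\<lambda>s. \<integral>x. \<rho> s x * \<psi> x \<partial>lborel) has_real_derivative
            \<rho>b * (\<Sum>k\<in>UNIV. \<integral>x. u t x $ k * pdl [k] \<psi> x \<partial>lborel)) (at t within {0..})"
proof -
  note C = evolve_Cc[OF hat_Cc(2), of _ t]
  \<comment> \<open>\<open>b\<close> is the spectral factor common to all fields. What remains of
    each term is a continuous symbol, so \<open>Cc_mult\<close> gives integrability at once.\<close>
  define b where "b \<xi> = h \<xi> * exp (l \<xi> * t)" for \<xi>
  have b: "Cc b" unfolding b_def by (rule Cc_exp_mult[OF h_Cc l_cont])
  have k: "(\<integral>x. u t x $ k * pdl [k] \<psi> x \<partial>lborel) = (\<integral>\<xi>. ((\<xi> $ k)\<^sup>2 / \<rho>b * l \<xi>) * b \<xi> * hartley \<psi> \<xi> \<partial>lborel)" for k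
    unfolding u_def vec_lambda_beta integral_hartley_pdl[OF C \<psi>] integral_hartley_test[OF Cc_mdiffs[OF C] \<psi>]
    by (simp add: mdiff_def[abs_def] u_hat_def evolve_def l_even h_even b_def power2_eq_square mult_ac)
  have j: "integrable lborel (\<lambda>\<xi>. ((\<xi> $ k)\<^sup>2 / \<rho>b * l \<xi>) * b \<xi> * hartley \<psi> \<xi>)" for k
    by (intro Cc_mult_hartley_integrable[OF _ \<psi>] Cc_mult[OF _ b] continuous_intros l_cont) (use \<rho>b in auto)
  have "\<rho>b * (\<Sum>k\<in>UNIV. \<integral>x. u t x $ k * pdl [k] \<psi> x \<partial>lborel)
     = (\<integral>\<xi>. \<rho>b * (\<Sum>k\<in>UNIV. ((\<xi> $ k)\<^sup>2 / \<rho>b * l \<xi>) * b \<xi> * hartley \<psi> \<xi>) \<partial>lborel)"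
    unfolding k integral_mult_right_zero using j by (simp only: Bochner_Integration.integral_sum)
  also have "(\<lambda>\<xi>. \<rho>b * (\<Sum>k\<in>UNIV. ((\<xi> $ k)\<^sup>2 / \<rho>b * l \<xi>) * b \<xi> * hartley \<psi> \<xi>))
      = (\<lambda>\<xi>. l \<xi> * evolve \<rho>_hat t \<xi> * hartley \<psi> \<xi>)"
    unfolding sum_distrib_right[symmetric] sum_divide_distrib[symmetric] power2_norm_vec[symmetric]
    using \<rho>b by (simp add: fun_eq_iff evolve_def \<rho>_hat_def b_def)
  finally show ?thesis
    unfolding \<rho>_def using DERIV_evolve[OF hat_Cc(1) \<psi>, of t] by simp
qed

text \<open>Every term has a symbol proportional to \<open>\<xi> $ j\<close>. Removing the common
  factor \<xi>_j b / \<rho>b leaves exactly the dispersion relation.\<close>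

lemma momentum_equation:
  assumes \<psi>: "test_fn \<psi>"
  shows "((\<lambda>s. \<integral>x. u s x $ j * \<psi> x \<partial>lborel) has_real_derivative
            (\<mu> / \<rho>b * (\<Sum>k\<in>UNIV. \<integral>x. u t x $ j * pdl [k,k] \<psi> x \<partial>lborel)
             + (\<mu> + \<mu>') / \<rho>b * (\<Sum>k\<in>UNIV. \<integral>x. u t x $ k * pdl [j,k] \<psi> x \<partial>lborel)
             + a / \<rho>b * (\<integral>x. \<rho> t x * pdl [j] \<psi> x \<partial>lborel)
             + \<gamma> * (\<integral>x. hartley (evolve \<phi>_hat t) x * pdl [j] \<psi> x \<partial>lborel))) (at t within {0..})"
    (is "(_ has_real_derivative ?R) _")
proof -
  note C = evolve_Cc[OF hat_Cc(1), of t] evolve_Cc[OF hat_Cc(2), of _ t] evolve_Cc[OF hat_Cc(3), of t]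
  define b where "b \<xi> = h \<xi> * exp (l \<xi> * t)" for \<xi>
  have b: "Cc b" unfolding b_def by (rule Cc_exp_mult[OF h_Cc l_cont])
  define I where "I c = (\<integral>\<xi>. c \<xi> * b \<xi> * hartley \<psi> \<xi> \<partial>lborel)" for c
  have int: "integrable lborel (\<lambda>\<xi>. c \<xi> * b \<xi> * hartley \<psi> \<xi>)" if "continuous_on UNIV c" for c
    by (intro Cc_mult_hartley_integrable[OF _ \<psi>] Cc_mult[OF that b])
  note simps = mdiff_def[abs_def] u_hat_def \<rho>_hat_def \<phi>_hat_def evolve_def l_even h_even I_def b_def power2_eq_square mult_ac
  have t1: "(\<integral>x. u t x $ j * pdl [k,k] \<psi> x \<partial>lborel) = I (\<lambda>\<xi>. (\<xi> $ k)\<^sup>2 * (\<xi> $ j / \<rho>b * l \<xi>))" for k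
    unfolding u_def vec_lambda_beta integral_hartley_pdl[OF C(2) \<psi>] integral_hartley_test[OF Cc_mdiffs[OF C(2)] \<psi>]
    by (simp add: simps)
  \<comment> \<open>For a gradient field \<nabla> div u = \<Delta> u, so the symbols coincide with
    those of \<open>t1\<close>; this is how the two viscosity coefficients add up to 2 \<mu> +
    \<mu>'.\<close>
  have t2: "(\<integral>x. u t x $ k * pdl [j,k] \<psi> x \<partial>lborel) = I (\<lambda>\<xi>. (\<xi> $ k)\<^sup>2 * (\<xi> $ j / \<rho>b * l \<xi>))" for k
    unfolding u_def vec_lambda_beta integral_hartley_pdl[OF C(2) \<psi>] integral_hartley_test[OF Cc_mdiffs[OF C(2)] \<psi>]
    by (simp add: simps)
  have t3: "(\<integral>x. \<rho> t x * pdl [j] \<psi> x \<partial>lborel) = I (\<lambda>\<xi>. \<xi> $ j * (norm \<xi>)\<^sup>2)"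
    unfolding \<rho>_def integral_hartley_pdl[OF C(1) \<psi>] integral_hartley_test[OF Cc_mdiffs[OF C(1)] \<psi>]
    by (simp add: simps)
  have t4: "(\<integral>x. hartley (evolve \<phi>_hat t) x * pdl [j] \<psi> x \<partial>lborel) = I (\<lambda>\<xi>. \<xi> $ j * ((norm \<xi>)\<^sup>2 / (1 + (norm \<xi>)\<^sup>2)))"
    unfolding integral_hartley_pdl[OF C(3) \<psi>] integral_hartley_test[OF Cc_mdiffs[OF C(3)] \<psi>]
    by (simp add: simps)
  have sum_I: "(\<Sum>k\<in>UNIV. I (\<lambda>\<xi>. (\<xi> $ k)\<^sup>2 * (\<xi> $ j / \<rho>b * l \<xi>))) = I (\<lambda>\<xi>. (norm \<xi>)\<^sup>2 * (\<xi> $ j / \<rho>b * l \<xi>))"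
  proof -
    have "integrable lborel (\<lambda>\<xi>. ((\<xi> $ k)\<^sup>2 * (\<xi> $ j / \<rho>b * l \<xi>)) * b \<xi> * hartley \<psi> \<xi>)" for k
      by (intro int continuous_intros l_cont) (use \<rho>b in auto)
    then show ?thesis
      unfolding I_def power2_norm_vec sum_distrib_right by (simp only: Bochner_Integration.integral_sum)
  qed
  define c1 where "c1 \<xi> = (norm \<xi>)\<^sup>2 * (\<xi> $ j / \<rho>b * l \<xi>)" for \<xi> :: R3
  define c2 where "c2 \<xi> = \<xi> $ j * (norm \<xi>)\<^sup>2" for \<xi> :: R3
  define c3 where "c3 \<xi> = \<xi> $ j * ((norm \<xi>)\<^sup>2 / (1 + (norm \<xi>)\<^sup>2))" for \<xi> :: R3
  have i1: "integrable lborel (\<lambda>\<xi>. c1 \<xi> * b \<xi> * hartley \<psi> \<xi>)"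
    unfolding c1_def by (intro int continuous_intros l_cont) (use \<rho>b in auto)
  have i2: "integrable lborel (\<lambda>\<xi>. c2 \<xi> * b \<xi> * hartley \<psi> \<xi>)"
    unfolding c2_def by (intro int continuous_intros)
  have i3: "integrable lborel (\<lambda>\<xi>. c3 \<xi> * b \<xi> * hartley \<psi> \<xi>)"
    unfolding c3_def by (intro int continuous_intros) (simp add: one_plus_norm_neq_0)
  have "?R = (2 * \<mu> + \<mu>') / \<rho>b * I c1 + a / \<rho>b * I c2 + \<gamma> * I c3"
    unfolding t1 t2 t3 t4 sum_I c1_def[symmetric] c2_def[symmetric] c3_def[symmetric]
    by (simp add: add_divide_distrib algebra_simps)
  also have "\<dots> = (\<integral>\<xi>. (2 * \<mu> + \<mu>') / \<rho>b * (c1 \<xi> * b \<xi> * hartley \<psi> \<xi>) + a / \<rho>b * (c2 \<xi> * b \<xi> * hartley \<psi> \<xi>)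
      + \<gamma> * (c3 \<xi> * b \<xi> * hartley \<psi> \<xi>) \<partial>lborel)"
    unfolding I_def using i1 i2 i3
    by (simp only: Bochner_Integration.integral_add integral_mult_right_zero integrable_mult_right Bochner_Integration.integrable_add)
  also have "(\<lambda>\<xi>. (2 * \<mu> + \<mu>') / \<rho>b * (c1 \<xi> * b \<xi> * hartley \<psi> \<xi>) + a / \<rho>b * (c2 \<xi> * b \<xi> * hartley \<psi> \<xi>)
      + \<gamma> * (c3 \<xi> * b \<xi> * hartley \<psi> \<xi>)) = (\<lambda>\<xi>. l \<xi> * evolve (u_hat j) t \<xi> * hartley \<psi> \<xi>)"
  proof
    fix \<xi>
    show "(2 * \<mu> + \<mu>') / \<rho>b * (c1 \<xi> * b \<xi> * hartley \<psi> \<xi>) + a / \<rho>b * (c2 \<xi> * b \<xi> * hartley \<psi> \<xi>)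
      + \<gamma> * (c3 \<xi> * b \<xi> * hartley \<psi> \<xi>) = l \<xi> * evolve (u_hat j) t \<xi> * hartley \<psi> \<xi>"
    \<comment> \<open>The dispersion relation is assumed only on the support of \<open>H\<close>;
      elsewhere both sides vanish.\<close>
    proof (cases "h \<xi> = 0")
      case True
      then show ?thesis by (simp add: b_def evolve_def u_hat_def)
    next
      case False
      define s where "s = (norm \<xi>)\<^sup>2"
      define \<nu> where "\<nu> = (2 * \<mu> + \<mu>') / \<rho>b"
      define q where "q = s / (1 + s)"
      have "(L s)\<^sup>2 + \<nu> * s * L s + s * (a + \<gamma> * \<rho>b / (1 + s)) = 0"
        using dispersion[of s] False by (simp add: h_def s_def \<nu>_def)
      then have *: "(l \<xi>)\<^sup>2 + \<nu> * s * l \<xi> + a * s + \<gamma> * \<rho>b * q = 0"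
        by (simp add: l_def s_def q_def algebra_simps)
      have "\<nu> * (c1 \<xi> * b \<xi> * hartley \<psi> \<xi>) + a / \<rho>b * (c2 \<xi> * b \<xi> * hartley \<psi> \<xi>)
          + \<gamma> * (c3 \<xi> * b \<xi> * hartley \<psi> \<xi>)
          = (\<nu> * s * l \<xi> + a * s + \<gamma> * \<rho>b * q) * (\<xi> $ j / \<rho>b * b \<xi> * hartley \<psi> \<xi>)"
        using \<rho>b by (simp add: c1_def c2_def c3_def s_def[symmetric] q_def[symmetric] field_simps)
      also have "\<nu> * s * l \<xi> + a * s + \<gamma> * \<rho>b * q = - (l \<xi>)\<^sup>2" using * by linarith
      finally show ?thesis
        by (simp add: \<nu>_def evolve_def u_hat_def b_def power2_eq_square mult_ac)
    qed
  qed
  finally have R: "?R = (\<integral>\<xi>. l \<xi> * evolve (u_hat j) t \<xi> * hartley \<psi> \<xi> \<partial>lborel)" .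
  show ?thesis
    unfolding R unfolding u_def vec_lambda_beta by (rule DERIV_evolve[OF hat_Cc(2) \<psi>])
qed

theorem solves: "lin_solution \<rho>b \<mu> \<mu>' a \<gamma> \<rho> u"
  unfolding lin_solution_def
proof (intro conjI exI[of _ "\<lambda>t. hartley (evolve \<phi>_hat t)"])
  show "C0H3 \<rho>" unfolding \<rho>_def[abs_def] by (rule C0H3_evolve[OF hat_Cc(1)])
  show "C0H3v u" unfolding C0H3v_def u_def[abs_def] vec_lambda_beta
    using C0H3_evolve[OF hat_Cc(2)] by simp
qed (use yukawa_pot_\<rho> continuity_equation momentum_equation in blast)+

lemma evolve_0: "evolve g 0 = g"
  by (simp add: evolve_def fun_eq_iff)

lemma L2normv_u: "(L2normv (u t))\<^sup>2 = (\<Sum>j\<in>UNIV. (L2norm (hartley (evolve (u_hat j) t)))\<^sup>2)"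
proof -
  have i: "integrable lborel (\<lambda>x. (hartley (evolve (u_hat j) t) x)\<^sup>2)" for j
    by (rule hartley_Plancherel(1)[OF evolve_Cc[OF hat_Cc(2)]])
  have "(L2normv (u t))\<^sup>2 = (\<integral>x. (\<Sum>j\<in>UNIV. (hartley (evolve (u_hat j) t) x)\<^sup>2) \<partial>lborel)"
    unfolding L2normv_def power2_norm_vec u_def vec_lambda_beta by (simp add: sum_nonneg)
  also have "\<dots> = (\<Sum>j\<in>UNIV. \<integral>x. (hartley (evolve (u_hat j) t) x)\<^sup>2 \<partial>lborel)"
    using i by (intro Bochner_Integration.integral_sum) auto
  finally show ?thesis by (simp add: L2norm_def)
qed

text \<open>Each velocity component obeys the same pair of exponential bounds, so their squares add
  up to bounds with unchanged rates for the vector norm.\<close>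

lemma growth_bounds:
  assumes m: "\<And>s. m \<le> L s" and M: "\<And>s. L s \<le> M" and t: "t \<ge> 0"
  shows "exp (m * t) * L2norm (\<rho> 0) \<le> L2norm (\<rho> t)" "L2norm (\<rho> t) \<le> exp (M * t) * L2norm (\<rho> 0)"
    and "exp (m * t) * L2normv (u 0) \<le> L2normv (u t)" "L2normv (u t) \<le> exp (M * t) * L2normv (u 0)"
proof -
  have lm: "m \<le> l \<xi>" and lM: "l \<xi> \<le> M" for \<xi>
    using m M by (simp_all add: l_def)
  have bounds: "exp (m * t) * L2norm (hartley g) \<le> L2norm (hartley (evolve g t))"
    "L2norm (hartley (evolve g t)) \<le> exp (M * t) * L2norm (hartley g)" if "Cc g" for g
    unfolding evolve_def[abs_def] using L2norm_hartley_exp_bounds[OF that l_cont lm lM t] by simp_all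
  show "exp (m * t) * L2norm (\<rho> 0) \<le> L2norm (\<rho> t)" "L2norm (\<rho> t) \<le> exp (M * t) * L2norm (\<rho> 0)"
    unfolding \<rho>_def evolve_0 using bounds[OF hat_Cc(1)] by auto
  have nonneg: "L2norm f \<ge> 0" "L2normv v \<ge> 0" for f v
    by (simp_all add: L2norm_def L2normv_def)
  have "(exp (m * t) * L2normv (u 0))\<^sup>2 \<le> (L2normv (u t))\<^sup>2"
    unfolding power_mult_distrib L2normv_u sum_distrib_left evolve_0
    by (unfold power_mult_distrib[symmetric], intro sum_mono power_mono bounds(1) hat_Cc mult_nonneg_nonneg nonneg) auto
  then show "exp (m * t) * L2normv (u 0) \<le> L2normv (u t)"
    by (rule power2_le_imp_le) (rule nonneg)
  have "(L2normv (u t))\<^sup>2 \<le> (exp (M * t) * L2normv (u 0))\<^sup>2"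
    unfolding power_mult_distrib L2normv_u sum_distrib_left evolve_0
    by (unfold power_mult_distrib[symmetric], intro sum_mono power_mono bounds(2) hat_Cc nonneg)
  then show "L2normv (u t) \<le> exp (M * t) * L2normv (u 0)"
    by (rule power2_le_imp_le) (simp add: nonneg)
qed

lemma initial_data_nonzero:
  assumes "s > 0" "H s \<noteq> 0" "L s \<noteq> 0"
  shows "L2norm (\<rho> 0) * L2normv (u 0) > 0"
proof -
  \<comment> \<open>A point of the shell on the first coordinate axis, where neither the density
    profile nor the first velocity profile vanishes.\<close>
  define \<xi> :: R3 where "\<xi> = sqrt s *\<^sub>R axis 1 1"
  have n: "(norm \<xi>)\<^sup>2 = s" and c: "\<xi> $ 1 = sqrt s"
    using assms by (simp_all add: \<xi>_def)
  have "L2norm (\<rho> 0) > 0"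
    unfolding \<rho>_def evolve_0 using assms
    by (intro L2norm_hartley_pos[OF hat_Cc(1), of \<xi>]) (simp add: \<rho>_hat_def h_def n)
  moreover have "L2norm (hartley (u_hat 1)) > 0"
    using assms \<rho>b
    by (intro L2norm_hartley_pos[OF hat_Cc(2), of _ \<xi>]) (simp add: u_hat_def h_def l_def n c)
  then have "(L2normv (u 0))\<^sup>2 > 0"
    unfolding L2normv_u evolve_0 by (intro sum_pos2[of _ 1]) auto
  then have "L2normv (u 0) > 0"
    unfolding zero_less_power2 by (simp add: L2normv_def less_le)
  ultimately show ?thesis by simp
qed

end

text \<open>\<open>growth_rate \<nu> q s\<close> is the larger root of \<open>X\<^sup>2 + \<nu> s X + s q(s)\<close>.\<close>

definition growth_rate :: "real \<Rightarrow> (real \<Rightarrow> real) \<Rightarrow> real \<Rightarrow> real" where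
  "growth_rate \<nu> q s = (- (\<nu> * s) + sqrt ((\<nu> * s)\<^sup>2 - 4 * s * q s)) / 2"

text \<open>A negative product of the roots makes the larger one positive. Dropping the square from
  the equation leaves \<nu> s r \<le> -s q(s), and s cancels: viscosity bounds the growth at high
  wave numbers.\<close>

lemma growth_rate:
  assumes "\<nu> > 0" "s > 0" "q s < 0"
  shows "growth_rate \<nu> q s > 0"
    and "(growth_rate \<nu> q s)\<^sup>2 + \<nu> * s * growth_rate \<nu> q s + s * q s = 0"
    and "growth_rate \<nu> q s \<le> \<bar>q s\<bar> / \<nu>"
proof -
  define r where "r = growth_rate \<nu> q s"
  define d where "d = sqrt ((\<nu> * s)\<^sup>2 - 4 * s * q s)"
  have sq: "s * q s < 0" using assms by (simp add: mult_pos_neg)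
  have d2: "d\<^sup>2 = (\<nu> * s)\<^sup>2 - 4 * s * q s"
    using sq zero_le_power2[of "\<nu> * s"] unfolding d_def by (intro real_sqrt_pow2) linarith
  have "(\<nu> * s)\<^sup>2 < d\<^sup>2" using sq d2 by linarith
  moreover have "d \<ge> 0" using sq zero_le_power2[of "\<nu> * s"] unfolding d_def by (intro real_sqrt_ge_zero) linarith
  ultimately have "\<nu> * s < d" by (rule power2_less_imp_less)
  moreover have r: "r = (d - \<nu> * s) / 2" by (simp add: r_def growth_rate_def d_def)
  ultimately have pos: "r > 0" by simp
  have d: "d = 2 * r + \<nu> * s" using r by (simp add: field_simps)
  have eq: "r\<^sup>2 + \<nu> * s * r + s * q s = 0"
    using d2 unfolding d by (simp add: power2_eq_square algebra_simps)
  have "s * (\<nu> * r) \<le> s * - q s"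
    using eq zero_le_power2[of r] unfolding mult_minus_right mult.left_commute[of s] mult.assoc by linarith
  then have "\<nu> * r \<le> - q s"
    using assms(2) by (simp only: mult_le_cancel_left_pos)
  then have "r \<le> \<bar>q s\<bar> / \<nu>" using assms by (simp add: field_simps)
  with pos eq show "growth_rate \<nu> q s > 0"
    "(growth_rate \<nu> q s)\<^sup>2 + \<nu> * s * growth_rate \<nu> q s + s * q s = 0"
    "growth_rate \<nu> q s \<le> \<bar>q s\<bar> / \<nu>"
    by (simp_all add: r_def)
qed

theorem theorem1p3:
  fixes \<rho>b \<gamma> \<mu> \<mu>' :: real and P :: "real \<Rightarrow> real"
  assumes "\<rho>b > 0" and "\<mu> > 0" and "2 * \<mu> + \<mu>' > 0"
    and "\<forall>n x. ((deriv ^^ n) P) differentiable (at x)"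
    and "deriv P \<rho>b + \<gamma> * \<rho>b < 0"
  shows "\<exists>\<Theta>>0. \<forall>\<Theta>b. 0 < \<Theta>b \<and> \<Theta>b \<le> \<Theta> / 2 \<longrightarrow>
    (\<exists>\<rho> u. lin_solution \<rho>b \<mu> \<mu>' (deriv P \<rho>b) \<gamma> \<rho> u \<and>
       L2norm (\<rho> 0) * L2normv (u 0) > 0 \<and>
       (\<forall>t\<ge>0. exp ((\<Theta> - \<Theta>b) * t) * L2norm (\<rho> 0) \<le> L2norm (\<rho> t) \<and>
               L2norm (\<rho> t) \<le> exp (\<Theta> * t) * L2norm (\<rho> 0) \<and>
               exp ((\<Theta> - \<Theta>b) * t) * L2normv (u 0) \<le> L2normv (u t) \<and>
               L2normv (u t) \<le> exp (\<Theta> * t) * L2normv (u 0)))"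
proof -
  define a where "a = deriv P \<rho>b"
  define \<nu> where "\<nu> = (2 * \<mu> + \<mu>') / \<rho>b"
  define q where "q s = a + \<gamma> * \<rho>b / (1 + s)" for s
  define r where "r = growth_rate \<nu> q"
  define \<Omega> where "\<Omega> = {s. s > 0 \<and> q s < 0}"
  \<comment> \<open>The supremum is a genuine one: \<open>s1\<close> below shows that \<Omega> is
    not empty, and \<open>bdd\<close> that the rates are bounded.\<close>
  define \<Theta> where "\<Theta> = Sup (r ` \<Omega>)"
  have \<nu>: "\<nu> > 0" using assms by (simp add: \<nu>_def)
  have q_cont: "continuous_on {0..} q"
    unfolding q_def by (intro continuous_intros) auto
  have r_cont: "continuous_on {0..} r"
    unfolding r_def growth_rate_def by (intro continuous_intros q_cont) auto
  have "q 0 < 0" using assms by (simp add: q_def a_def)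
  \<comment> \<open>The hypothesis is the sign of q at 0, but membership in \<Omega> needs a
    positive s; continuity from the right supplies one.\<close>
  have "(q \<longlongrightarrow> q 0) (at_right 0)"
    using q_cont by (auto simp: continuous_on_def intro: tendsto_within_subset)
  then have "eventually (\<lambda>s. q s < 0) (at_right 0)"
    using \<open>q 0 < 0\<close> by (rule order_tendstoD)
  then have "eventually (\<lambda>s. s \<in> \<Omega>) (at_right 0)"
    using eventually_at_right_less[of 0] by eventually_elim (simp add: \<Omega>_def)
  then obtain s1 where s1: "s1 \<in> \<Omega>"
    using eventually_happens' trivial_limit_at_right_real by blast
  have r: "r s > 0" "(r s)\<^sup>2 + \<nu> * s * r s + s * q s = 0" "r s \<le> (\<bar>a\<bar> + \<bar>\<gamma> * \<rho>b\<bar>) / \<nu>" if "s \<in> \<Omega>" for s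
  proof -
    have s: "s > 0" "q s < 0" using that by (auto simp: \<Omega>_def)
    show "r s > 0" "(r s)\<^sup>2 + \<nu> * s * r s + s * q s = 0"
      unfolding r_def using growth_rate[of \<nu> _ q, OF \<nu> s] by auto
    have "\<bar>\<gamma> * \<rho>b / (1 + s)\<bar> \<le> \<bar>\<gamma> * \<rho>b\<bar>"
      using s mult_left_mono[of 1 "1 + s" "\<bar>\<gamma> * \<rho>b\<bar>"] by (simp add: abs_divide divide_le_eq)
    then have "\<bar>q s\<bar> \<le> \<bar>a\<bar> + \<bar>\<gamma> * \<rho>b\<bar>"
      unfolding q_def by linarith
    then have "\<bar>q s\<bar> / \<nu> \<le> (\<bar>a\<bar> + \<bar>\<gamma> * \<rho>b\<bar>) / \<nu>"
      using \<nu> by (intro divide_right_mono) auto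
    with growth_rate(3)[of \<nu> _ q, OF \<nu> s] show "r s \<le> (\<bar>a\<bar> + \<bar>\<gamma> * \<rho>b\<bar>) / \<nu>"
      unfolding r_def by linarith
  qed
  have bdd: "bdd_above (r ` \<Omega>)"
    using r(3) by (intro bdd_aboveI2)
  have r_le: "r s \<le> \<Theta>" if "s \<in> \<Omega>" for s
    unfolding \<Theta>_def using bdd that by (rule cSUP_upper2[OF _ _ order_refl])
  have \<Theta>_pos: "\<Theta> > 0"
    using r(1)[OF s1] r_le[OF s1] by linarith
  show ?thesis
  proof (intro exI[of _ \<Theta>] conjI allI impI \<Theta>_pos)
    fix \<Theta>b assume \<Theta>b: "0 < \<Theta>b \<and> \<Theta>b \<le> \<Theta> / 2"
    \<comment> \<open>Since \<Theta>b \<le> \<Theta> / 2, this lower rate is positive. An exponent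
      bounded below by it never vanishes, which keeps the initial velocity nonzero.\<close>
    define m where "m = \<Theta> - \<Theta>b"
    have m: "0 < m" "m < \<Theta>" using \<Theta>b \<Theta>_pos by (auto simp: m_def)
    \<comment> \<open>Any number below a supremum is exceeded by some member; here the strictness of
      0 < \<Theta>b is spent.\<close>
    obtain s0 where s0: "s0 \<in> \<Omega>" "m < r s0"
      using m(2) less_cSUP_iff[OF _ bdd, of m] s1 unfolding \<Theta>_def by blast
    have "s0 > 0" "q s0 < 0" using s0 by (auto simp: \<Omega>_def)
    have "isCont q s0" "isCont r s0"
      using q_cont r_cont \<open>s0 > 0\<close> by (auto intro: continuous_on_interior)
    then have "eventually (\<lambda>s. q s < 0) (at s0)" "eventually (\<lambda>s. m < r s) (at s0)"
      using \<open>q s0 < 0\<close> s0(2) by (auto simp: isCont_def intro: order_tendstoD)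
    moreover have "eventually (\<lambda>s. 0 < s) (at s0)"
      using \<open>s0 > 0\<close> order_tendstoD(1)[OF tendsto_ident_at] by blast
    ultimately have "eventually (\<lambda>s. s \<in> \<Omega> \<and> m < r s) (at s0)"
      by eventually_elim (simp add: \<Omega>_def)
    \<comment> \<open>The filter \<open>at s0\<close> omits the centre, so \<open>s0\<close> is
      treated separately below.\<close>
    then obtain \<delta> where \<delta>: "\<delta> > 0" "\<And>s. s \<noteq> s0 \<Longrightarrow> \<bar>s - s0\<bar> < \<delta> \<Longrightarrow> s \<in> \<Omega> \<and> m < r s"
      unfolding eventually_at dist_real_def by blast
    \<comment> \<open>A continuous tent around \<open>s0\<close>, positive exactly where |s - s0| <
      \<delta>, so the spectrum stays in the unstable range.\<close>
    define H where "H s = max 0 (\<delta> - \<bar>s - s0\<bar>)" for s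
    \<comment> \<open>The truncation coincides with the true root on the support of
      \<open>H\<close>, since there m < r(s) \<le> \<Theta>, and it provides the global bounds
      required by the mode construction.\<close>
    define L where "L s = max m (min \<Theta> (r s))" for s
    have H: "s \<in> \<Omega> \<and> m < r s" if "H s \<noteq> 0" for s
      using that \<delta>(2)[of s] s0 by (cases "s = s0") (auto simp: H_def)
    have L: "L s = r s" if "H s \<noteq> 0" for s
      using H[OF that] r_le[of s] by (auto simp: L_def)
    interpret radial_mode \<rho>b \<mu> \<mu>' a \<gamma> \<Theta> "s0 + \<delta>" L H
    proof
      show "continuous_on {0..} L" unfolding L_def by (intro continuous_intros r_cont)
      show "continuous_on {0..} H" unfolding H_def by (intro continuous_intros)
      show "\<bar>L s\<bar> \<le> \<Theta>" for s using m by (auto simp: L_def)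
      show "H s = 0" if "s > s0 + \<delta>" for s using that by (auto simp: H_def)
      show "(L s)\<^sup>2 + (2 * \<mu> + \<mu>') / \<rho>b * s * L s + s * (a + \<gamma> * \<rho>b / (1 + s)) = 0" if "H s \<noteq> 0" for s
        using r(2)[of s] H[OF that] unfolding L[OF that] \<nu>_def q_def by blast
    qed (rule assms(1))
    have bounds: "m \<le> L s" "L s \<le> \<Theta>" for s using m by (auto simp: L_def)
    have "H s0 \<noteq> 0" "L s0 \<noteq> 0" using \<delta>(1) m(1) bounds(1)[of s0] by (auto simp: H_def)
    then show "\<exists>\<rho> u. lin_solution \<rho>b \<mu> \<mu>' (deriv P \<rho>b) \<gamma> \<rho> u \<and>
       L2norm (\<rho> 0) * L2normv (u 0) > 0 \<and>
       (\<forall>t\<ge>0. exp ((\<Theta> - \<Theta>b) * t) * L2norm (\<rho> 0) \<le> L2norm (\<rho> t) \<and>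
               L2norm (\<rho> t) \<le> exp (\<Theta> * t) * L2norm (\<rho> 0) \<and>
               exp ((\<Theta> - \<Theta>b) * t) * L2normv (u 0) \<le> L2normv (u t) \<and>
               L2normv (u t) \<le> exp (\<Theta> * t) * L2normv (u 0))"
      using solves initial_data_nonzero[OF \<open>s0 > 0\<close>] growth_bounds[OF bounds]
      unfolding a_def m_def by (intro exI[of _ \<rho>] exI[of _ u]) blast
  qed
qed

end
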